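(* Let $E,F$ be two finite groups and $H,K$ two infinite finitely generated groups satisfying the thick bigon property. If the wreath products $E\wr H$ and $F\wr K$ are quasi-isometric, then $|E|$ and $|F|$ have the same prime divisors.
   Context: Finitely generated groups are endowed with word metrics. Wreath product: $E\wr H=\left(\bigoplus_H E\right)\rtimes H$, where $H$ permutes the coordinates through left-multiplication. Coarse homotopy: for $C\ge 0$, two paths $\alpha,\beta$ in a metric space with the same endpoints are $C$-coarsely homotopic if there is a sequence of paths $\gamma_0=\alpha,\gamma_1,\dots,\gamma_n=\beta$ such that each $\gamma_{i+1}$ is obtained from $\gamma_i$ by replacing a subpath $\zeta$ with a path $\xi$ with the same endpoints satisfying $\mathrm{diam}(\zeta\cup\xi)\le C$. Thick bigon property: a metric space $X$ has it if there exists $C\ge 0$ such that, for every $R\ge 0$, the following holds for some $L\ge 0$: any two points $x,y\in X$ are connected by some path $\gamma_1$ such that, for every $p\in\gamma_1$ with $d(x,p),d(y,p)\ge L$, there is a path $\gamma_2$ between $x$ and $y$ that is $C$-coarsely homotopic to $\gamma_1$ and avoids the ball $B(p,R)$. A finitely generated group has the property if its Cayley graph with respect to a finite generating set does (independently of the choice). *)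

theory Defs
  imports "HOL-Analysis.Analysis" "HOL-Algebra.Product_Groups"
    "HOL-Computational_Algebra.Primes"
begin

section \<open>Word metrics\<close>

definition finite_generating_set :: "('a, 'm) monoid_scheme \<Rightarrow> 'a set \<Rightarrow> bool" where
  "finite_generating_set G S \<longleftrightarrow> finite S \<and> S \<subseteq> carrier G \<and> generate G S = carrier G"

definition finitely_generated_group :: "('a, 'm) monoid_scheme \<Rightarrow> bool" where
  "finitely_generated_group G \<longleftrightarrow> group G \<and> (\<exists>S. finite_generating_set G S)"

definition word_value :: "('a, 'm) monoid_scheme \<Rightarrow> 'a list \<Rightarrow> 'a" where
  "word_value G w = foldr (\<otimes>\<^bsub>G\<^esub>) w \<one>\<^bsub>G\<^esub>"

definition letters :: "('a, 'm) monoid_scheme \<Rightarrow> 'a set \<Rightarrow> 'a set" where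
  "letters G S = S \<union> (\<lambda>s. inv\<^bsub>G\<^esub> s) ` S"

definition word_length :: "('a, 'm) monoid_scheme \<Rightarrow> 'a set \<Rightarrow> 'a \<Rightarrow> nat" where
  "word_length G S g =
     (LEAST n. \<exists>w. length w = n \<and> set w \<subseteq> letters G S \<and> word_value G w = g)"

text \<open>The value outside the carrier is irrelevant; the guard makes the function symmetric
  everywhere, as the locale \<^locale>\<open>Metric_space\<close> demands.\<close>

definition word_dist :: "('a, 'm) monoid_scheme \<Rightarrow> 'a set \<Rightarrow> 'a \<Rightarrow> 'a \<Rightarrow> real" where
  "word_dist G S g h =
     (if g \<in> carrier G \<and> h \<in> carrier G then real (word_length G S (inv\<^bsub>G\<^esub> g \<otimes>\<^bsub>G\<^esub> h)) else 0)"

lemma word_value_append: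
  assumes "group G" "set v \<subseteq> carrier G" "set w \<subseteq> carrier G"
  shows "word_value G w \<in> carrier G" "word_value G (v @ w) = word_value G v \<otimes>\<^bsub>G\<^esub> word_value G w"
proof -
  interpret group G by fact
  have c: "word_value G u \<in> carrier G" if "set u \<subseteq> carrier G" for u
    using that by (induction u) (auto simp: word_value_def)
  show "word_value G w \<in> carrier G" using c assms by blast
  show "word_value G (v @ w) = word_value G v \<otimes>\<^bsub>G\<^esub> word_value G w"
    using assms(2)
  proof (induction v)
    case Nil then show ?case using c[OF assms(3)] by (simp add: word_value_def)
  next
    case (Cons a v)
    then show ?case using c[of v] c[of w] assms(3) by (simp add: word_value_def m_assoc)
  qed
qed

lemma word_value_inverse:
  assumes "group G" "set w \<subseteq> carrier G"
  shows "word_value G (rev (map (\<lambda>s. inv\<^bsub>G\<^esub> s) w)) = inv\<^bsub>G\<^esub> (word_value G w)"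
proof -
  interpret group G by fact
  show ?thesis using assms(2)
  proof (induction w)
    case Nil then show ?case by (simp add: word_value_def)
  next
    case (Cons a w)
    have i: "set (rev (map (\<lambda>s. inv\<^bsub>G\<^esub> s) w)) \<subseteq> carrier G" using Cons.prems by auto
    have "word_value G (rev (map (\<lambda>s. inv\<^bsub>G\<^esub> s) (a # w))) = inv\<^bsub>G\<^esub> (word_value G w) \<otimes>\<^bsub>G\<^esub> word_value G [inv\<^bsub>G\<^esub> a]"
      using word_value_append(2)[OF assms(1) i, of "[inv\<^bsub>G\<^esub> a]"] Cons by auto
    also have "\<dots> = inv\<^bsub>G\<^esub> (word_value G (a # w))"
      using Cons.prems word_value_append(1)[OF assms(1), of "[]" w]
      by (simp add: word_value_def inv_mult_group)
    finally show ?case .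
  qed
qed

context
  fixes G :: "('a, 'm) monoid_scheme" and S
  assumes G: "group G" and S: "finite_generating_set G S"
begin

interpretation group G by (rule G)

lemma letters_carrier: "letters G S \<subseteq> carrier G"
  using S by (auto simp: letters_def finite_generating_set_def)

lemma word_exists:
  assumes "g \<in> carrier G" shows "\<exists>w. set w \<subseteq> letters G S \<and> word_value G w = g"
proof -
  have "g \<in> generate G S" using assms S by (simp add: finite_generating_set_def)
  then show ?thesis
  proof induction
    case one show ?case by (rule exI[of _ "[]"]) (simp add: word_value_def)
  next
    case (incl h) then show ?case using S
      by (intro exI[of _ "[h]"]) (auto simp: word_value_def letters_def finite_generating_set_def)
  next
    case (inv h) then show ?case using S
      by (intro exI[of _ "[inv\<^bsub>G\<^esub> h]"]) (auto simp: word_value_def letters_def finite_generating_set_def)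
  next
    case (eng h1 h2)
    then obtain v w where "set v \<subseteq> letters G S" "word_value G v = h1" "set w \<subseteq> letters G S" "word_value G w = h2"
      by blast
    then show ?case using word_value_append(2)[OF G, of v w] letters_carrier
      by (intro exI[of _ "v @ w"]) auto
  qed
qed

lemma word_length_witness:
  assumes "g \<in> carrier G"
  obtains w where "length w = word_length G S g" "set w \<subseteq> letters G S" "word_value G w = g"
  using LeastI_ex[of "\<lambda>n. \<exists>w. length w = n \<and> set w \<subseteq> letters G S \<and> word_value G w = g"] word_exists[OF assms]
  unfolding word_length_def by blast

lemma word_length_le:
  assumes "set w \<subseteq> letters G S"
  shows "word_length G S (word_value G w) \<le> length w"
  unfolding word_length_def by (rule Least_le) (use assms in auto)

lemma word_length_inv_le:
  assumes "g \<in> carrier G" shows "word_length G S (inv\<^bsub>G\<^esub> g) \<le> word_length G S g"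
proof -
  obtain w where w: "length w = word_length G S g" "set w \<subseteq> letters G S" "word_value G w = g"
    using word_length_witness[OF assms] .
  have "set (rev (map (\<lambda>s. inv\<^bsub>G\<^esub> s) w)) \<subseteq> letters G S"
  proof -
    have "inv\<^bsub>G\<^esub> s \<in> letters G S" if "s \<in> letters G S" for s
      using that S by (auto simp: letters_def finite_generating_set_def subset_iff)
    then show ?thesis using w(2) by auto
  qed
  from word_length_le[OF this] show ?thesis
    using word_value_inverse[OF G, of w] w letters_carrier by auto
qed

lemma word_length_mult_le:
  assumes "g \<in> carrier G" "h \<in> carrier G"
  shows "word_length G S (g \<otimes>\<^bsub>G\<^esub> h) \<le> word_length G S g + word_length G S h"
proof -
  obtain v where v: "length v = word_length G S g" "set v \<subseteq> letters G S" "word_value G v = g"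
    using word_length_witness[OF assms(1)] .
  obtain w where w: "length w = word_length G S h" "set w \<subseteq> letters G S" "word_value G w = h"
    using word_length_witness[OF assms(2)] .
  show ?thesis
    using word_length_le[of "v @ w"] v w word_value_append(2)[OF G, of v w] letters_carrier by auto
qed

lemma word_length_eq_0:
  assumes "g \<in> carrier G" shows "word_length G S g = 0 \<longleftrightarrow> g = \<one>\<^bsub>G\<^esub>"
proof
  assume "word_length G S g = 0"
  then show "g = \<one>\<^bsub>G\<^esub>" using word_length_witness[OF assms]
    by (metis length_0_conv word_value_def foldr_Nil id_apply)
next
  assume "g = \<one>\<^bsub>G\<^esub>" then show "word_length G S g = 0"
    using word_length_le[of "[]"] by (simp add: word_value_def)
qed

lemma Metric_space_word_dist: "Metric_space (carrier G) (word_dist G S)"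
proof
  fix x y
  show "0 \<le> word_dist G S x y" by (simp add: word_dist_def)
  have *: "word_dist G S x y \<le> word_dist G S y x" for x y
    using word_length_inv_le[of "inv\<^bsub>G\<^esub> y \<otimes>\<^bsub>G\<^esub> x"] by (auto simp: word_dist_def inv_mult_group)
  show "word_dist G S x y = word_dist G S y x" by (intro antisym *)
  assume xy: "x \<in> carrier G" "y \<in> carrier G"
  have canc: "x \<otimes>\<^bsub>G\<^esub> (inv\<^bsub>G\<^esub> x \<otimes>\<^bsub>G\<^esub> u) = u" if "x \<in> carrier G" "u \<in> carrier G" for x u
    using that by (simp add: m_assoc[symmetric])
  have "inv\<^bsub>G\<^esub> x \<otimes>\<^bsub>G\<^esub> y = \<one>\<^bsub>G\<^esub> \<longleftrightarrow> x = y"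
    using canc[OF xy] xy by auto
  then show "word_dist G S x y = 0 \<longleftrightarrow> x = y"
    using word_length_eq_0[of "inv\<^bsub>G\<^esub> x \<otimes>\<^bsub>G\<^esub> y"] xy by (simp add: word_dist_def)
  fix z assume z: "z \<in> carrier G"
  have "(inv\<^bsub>G\<^esub> x \<otimes>\<^bsub>G\<^esub> y) \<otimes>\<^bsub>G\<^esub> (inv\<^bsub>G\<^esub> y \<otimes>\<^bsub>G\<^esub> z) = inv\<^bsub>G\<^esub> x \<otimes>\<^bsub>G\<^esub> z"
    using xy z canc[of y z] by (simp add: m_assoc)
  then show "word_dist G S x z \<le> word_dist G S x y + word_dist G S y z"
    using word_length_mult_le[of "inv\<^bsub>G\<^esub> x \<otimes>\<^bsub>G\<^esub> y" "inv\<^bsub>G\<^esub> y \<otimes>\<^bsub>G\<^esub> z"] xy z by (simp add: word_dist_def)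
qed

end


section \<open>Quasi-isometries\<close>

definition quasi_isometric ::
    "'a set \<Rightarrow> ('a \<Rightarrow> 'a \<Rightarrow> real) \<Rightarrow> 'b set \<Rightarrow> ('b \<Rightarrow> 'b \<Rightarrow> real) \<Rightarrow> bool" where
  "quasi_isometric M d M' d' \<longleftrightarrow>
     (\<exists>f A B. f \<in> M \<rightarrow> M' \<and> 1 \<le> A \<and> 0 \<le> B
        \<and> (\<forall>x\<in>M. \<forall>y\<in>M. d x y / A - B \<le> d' (f x) (f y) \<and> d' (f x) (f y) \<le> A * d x y + B)
        \<and> (\<forall>z\<in>M'. \<exists>x\<in>M. d' z (f x) \<le> B))"

text \<open>Word metrics for different finite generating sets are bi-Lipschitz equivalent, so it
  does not matter which ones are chosen here.\<close>

definition quasi_isometric_groups ::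
    "('a, 'm) monoid_scheme \<Rightarrow> ('b, 'n) monoid_scheme \<Rightarrow> bool" where
  "quasi_isometric_groups G H \<longleftrightarrow>
     (\<exists>S T. finite_generating_set G S \<and> finite_generating_set H T
        \<and> quasi_isometric (carrier G) (word_dist G S) (carrier H) (word_dist H T))"


section \<open>Wreath products\<close>

definition wreath_product :: "('e, 'm) monoid_scheme \<Rightarrow> ('h, 'n) monoid_scheme \<Rightarrow> (('h \<Rightarrow> 'e) \<times> 'h) monoid"
  where
  "wreath_product E H =
     \<lparr>carrier = carrier (sum_group (carrier H) (\<lambda>_. E)) \<times> carrier H,
      monoid.mult = (\<lambda>(a, g) (b, h).
        (a \<otimes>\<^bsub>sum_group (carrier H) (\<lambda>_. E)\<^esub> (\<lambda>x\<in>carrier H. b (inv\<^bsub>H\<^esub> g \<otimes>\<^bsub>H\<^esub> x)), g \<otimes>\<^bsub>H\<^esub> h)),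
      one = (\<one>\<^bsub>sum_group (carrier H) (\<lambda>_. E)\<^esub>, \<one>\<^bsub>H\<^esub>)\<rparr>"

lemma group_wreath_product:
  assumes "group E" "group H"
  shows "group (wreath_product E H)"
proof -
  interpret E: group E by fact
  interpret H: group H by fact
  let ?B = "{a \<in> carrier H \<rightarrow>\<^sub>E carrier E. finite {x \<in> carrier H. a x \<noteq> \<one>\<^bsub>E\<^esub>}}"
  let ?sh = "\<lambda>g b. \<lambda>x\<in>carrier H. b (inv\<^bsub>H\<^esub> g \<otimes>\<^bsub>H\<^esub> x)"
  interpret B: group "sum_group (carrier H) (\<lambda>_. E)" using assms by simp
  have carB: "carrier (sum_group (carrier H) (\<lambda>_. E)) = ?B"
    by (simp add: carrier_sum_group assms)
  have sh: "?sh g b \<in> ?B" if "g \<in> carrier H" "b \<in> ?B" for g b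
  proof -
    have "{x \<in> carrier H. ?sh g b x \<noteq> \<one>\<^bsub>E\<^esub>} \<subseteq> (\<lambda>x. g \<otimes>\<^bsub>H\<^esub> x) ` {x \<in> carrier H. b x \<noteq> \<one>\<^bsub>E\<^esub>}"
    proof
      fix x assume "x \<in> {x \<in> carrier H. ?sh g b x \<noteq> \<one>\<^bsub>E\<^esub>}"
      then show "x \<in> (\<lambda>x. g \<otimes>\<^bsub>H\<^esub> x) ` {x \<in> carrier H. b x \<noteq> \<one>\<^bsub>E\<^esub>}"
        using that by (intro image_eqI[of _ _ "inv\<^bsub>H\<^esub> g \<otimes>\<^bsub>H\<^esub> x"]) (auto simp: H.m_assoc[symmetric])
    qed
    moreover have "finite ((\<lambda>x. g \<otimes>\<^bsub>H\<^esub> x) ` {x \<in> carrier H. b x \<noteq> \<one>\<^bsub>E\<^esub>})" using that by simp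
    ultimately have "finite {x \<in> carrier H. ?sh g b x \<noteq> \<one>\<^bsub>E\<^esub>}" by (rule finite_subset)
    moreover have "?sh g b \<in> carrier H \<rightarrow>\<^sub>E carrier E"
    proof (rule restrict_PiE_iff[THEN iffD2], rule ballI)
      fix x assume "x \<in> carrier H"
      then have "inv\<^bsub>H\<^esub> g \<otimes>\<^bsub>H\<^esub> x \<in> carrier H" using that by simp
      then show "b (inv\<^bsub>H\<^esub> g \<otimes>\<^bsub>H\<^esub> x) \<in> carrier E" using that by (blast dest: PiE_mem)
    qed
    ultimately show ?thesis by blast
  qed
  have sh1: "?sh \<one>\<^bsub>H\<^esub> b = b" if "b \<in> ?B" for b
    using that by (auto simp: fun_eq_iff PiE_iff extensional_def)
  have shm: "?sh g (?sh h b) = ?sh (g \<otimes>\<^bsub>H\<^esub> h) b" if "g \<in> carrier H" "h \<in> carrier H" for g h b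
    using that by (auto simp: fun_eq_iff H.inv_mult_group H.m_assoc)
  have mult: "a \<otimes>\<^bsub>sum_group (carrier H) (\<lambda>_. E)\<^esub> b = (\<lambda>x\<in>carrier H. a x \<otimes>\<^bsub>E\<^esub> b x)" for a b
    by simp
  have shd: "?sh g (a \<otimes>\<^bsub>sum_group (carrier H) (\<lambda>_. E)\<^esub> b) =
      ?sh g a \<otimes>\<^bsub>sum_group (carrier H) (\<lambda>_. E)\<^esub> ?sh g b" if "g \<in> carrier H" for g a b
    using that by (auto simp: fun_eq_iff)
  have m: "(a, g) \<otimes>\<^bsub>wreath_product E H\<^esub> (b, h) = (a \<otimes>\<^bsub>sum_group (carrier H) (\<lambda>_. E)\<^esub> ?sh g b, g \<otimes>\<^bsub>H\<^esub> h)"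
    for a g b h by (simp add: wreath_product_def)
  have c: "carrier (wreath_product E H) = carrier (sum_group (carrier H) (\<lambda>_. E)) \<times> carrier H"
    and o: "\<one>\<^bsub>wreath_product E H\<^esub> = (\<one>\<^bsub>sum_group (carrier H) (\<lambda>_. E)\<^esub>, \<one>\<^bsub>H\<^esub>)"
    by (simp_all add: wreath_product_def)
  note sh' = sh[folded carB] and sh1' = sh1[folded carB]
  show ?thesis
  proof (rule groupI)
    fix x y assume "x \<in> carrier (wreath_product E H)" "y \<in> carrier (wreath_product E H)"
    moreover obtain a g b h where xy: "x = (a, g)" "y = (b, h)" by (metis surj_pair)
    ultimately have mem: "a \<in> carrier (sum_group (carrier H) (\<lambda>_. E))" "b \<in> carrier (sum_group (carrier H) (\<lambda>_. E))"
      "g \<in> carrier H" "h \<in> carrier H"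
      unfolding c by blast+
    show "x \<otimes>\<^bsub>wreath_product E H\<^esub> y \<in> carrier (wreath_product E H)"
      unfolding xy m c
      by (rule SigmaI[OF B.m_closed[OF mem(1) sh'[OF mem(3,2)]] H.m_closed[OF mem(3,4)]])
  next
    show "\<one>\<^bsub>wreath_product E H\<^esub> \<in> carrier (wreath_product E H)"
      unfolding c o by (rule SigmaI[OF B.one_closed H.one_closed])
  next
    fix x y z assume *: "x \<in> carrier (wreath_product E H)" "y \<in> carrier (wreath_product E H)" "z \<in> carrier (wreath_product E H)"
    obtain a g b h d k where xyz: "x = (a, g)" "y = (b, h)" "z = (d, k)" by (metis surj_pair)
    have mem: "a \<in> carrier (sum_group (carrier H) (\<lambda>_. E))" "b \<in> carrier (sum_group (carrier H) (\<lambda>_. E))"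
      "d \<in> carrier (sum_group (carrier H) (\<lambda>_. E))" "g \<in> carrier H" "h \<in> carrier H" "k \<in> carrier H"
      using * unfolding xyz c by blast+
    show "x \<otimes>\<^bsub>wreath_product E H\<^esub> y \<otimes>\<^bsub>wreath_product E H\<^esub> z =
        x \<otimes>\<^bsub>wreath_product E H\<^esub> (y \<otimes>\<^bsub>wreath_product E H\<^esub> z)"
      unfolding xyz m shd[OF mem(4)] shm[OF mem(4,5)]
      using B.m_assoc[OF mem(1) sh'[OF mem(4,2)] sh'[OF H.m_closed[OF mem(4,5)] mem(3)]] H.m_assoc[OF mem(4-6)]
      by (simp only:)
  next
    fix x assume *: "x \<in> carrier (wreath_product E H)"
    obtain a g where x: "x = (a, g)" by force
    have mem: "a \<in> carrier (sum_group (carrier H) (\<lambda>_. E))" "g \<in> carrier H"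
      using * unfolding x c by blast+
    show "\<one>\<^bsub>wreath_product E H\<^esub> \<otimes>\<^bsub>wreath_product E H\<^esub> x = x"
      unfolding x o m sh1'[OF mem(1)] using B.l_one[OF mem(1)] H.l_one[OF mem(2)] by (simp only:)
    let ?b = "inv\<^bsub>sum_group (carrier H) (\<lambda>_. E)\<^esub> ?sh (inv\<^bsub>H\<^esub> g) a"
    have "?b \<in> carrier (sum_group (carrier H) (\<lambda>_. E))"
      using sh'[OF H.inv_closed[OF mem(2)] mem(1)] by (rule B.inv_closed)
    moreover have "?b \<otimes>\<^bsub>sum_group (carrier H) (\<lambda>_. E)\<^esub> ?sh (inv\<^bsub>H\<^esub> g) a = \<one>\<^bsub>sum_group (carrier H) (\<lambda>_. E)\<^esub>"
      using sh'[OF H.inv_closed[OF mem(2)] mem(1)] by (rule B.l_inv)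
    ultimately have "(?b, inv\<^bsub>H\<^esub> g) \<in> carrier (wreath_product E H)"
      "(?b, inv\<^bsub>H\<^esub> g) \<otimes>\<^bsub>wreath_product E H\<^esub> x = \<one>\<^bsub>wreath_product E H\<^esub>"
      unfolding x c o m using H.inv_closed[OF mem(2)] H.l_inv[OF mem(2)] by (blast, simp only:)
    then show "\<exists>y\<in>carrier (wreath_product E H). y \<otimes>\<^bsub>wreath_product E H\<^esub> x = \<one>\<^bsub>wreath_product E H\<^esub>"
      by blast
  qed
qed


section \<open>The thick bigon property\<close>

context Metric_space
begin

text \<open>The replacing path is parametrised by the same interval \<open>[a, b]\<close> as the
  replaced subpath. This is no restriction: for \<open>C > 0\<close> a reparametrisation of
  a path is itself a composition of finitely many such replacements, by uniform continuity.
  The last conjunct says that the union of the two images has diameter at most \<open>C\<close>.\<close>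

definition coarse_move :: "real \<Rightarrow> (real \<Rightarrow> 'a) \<Rightarrow> (real \<Rightarrow> 'a) \<Rightarrow> bool" where
  "coarse_move C g h \<longleftrightarrow> pathin mtopology g \<and> pathin mtopology h \<and>
     (\<exists>a b. 0 \<le> a \<and> a \<le> b \<and> b \<le> 1
        \<and> (\<forall>t\<in>{0..1} - {a<..<b}. h t = g t)
        \<and> (\<forall>u \<in> g ` {a..b} \<union> h ` {a..b}. \<forall>v \<in> g ` {a..b} \<union> h ` {a..b}. d u v \<le> C))"

definition coarsely_homotopic :: "real \<Rightarrow> (real \<Rightarrow> 'a) \<Rightarrow> (real \<Rightarrow> 'a) \<Rightarrow> bool" where
  "coarsely_homotopic C g h \<longleftrightarrow>
     pathin mtopology g \<and> pathin mtopology h \<and> g 0 = h 0 \<and> g 1 = h 1 \<and> (coarse_move C)\<^sup>*\<^sup>* g h"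

definition thick_bigon :: bool where
  "thick_bigon \<longleftrightarrow>
     (\<exists>C\<ge>0. \<forall>R\<ge>0. \<exists>L\<ge>0. \<forall>x\<in>M. \<forall>y\<in>M.
        \<exists>g. pathin mtopology g \<and> g 0 = x \<and> g 1 = y \<and>
          (\<forall>p \<in> g ` {0..1}. d x p \<ge> L \<and> d y p \<ge> L \<longrightarrow>
             (\<exists>h. pathin mtopology h \<and> h 0 = x \<and> h 1 = y \<and> coarsely_homotopic C g h
                \<and> h ` {0..1} \<inter> mcball p R = {})))"

end


section \<open>Cayley graphs as metric spaces\<close>

text \<open>The Cayley graph is the geometric realisation of a simplicial graph, with every edge of
  length 1. A point is given by its barycentric coordinates: \<open>edge_point g h t\<close> is the
  point at distance \<open>t\<close> from \<open>g\<close> on the edge from \<open>g\<close> to \<open>h\<close>, and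
  \<open>edge_point g g t\<close> is the vertex \<open>g\<close>.\<close>

definition edge_point :: "'a \<Rightarrow> 'a \<Rightarrow> real \<Rightarrow> 'a \<Rightarrow> real" where
  "edge_point g h t = (\<lambda>v. (1 - t) * of_bool (v = g) + t * of_bool (v = h))"

definition cayley_segment :: "('a, 'm) monoid_scheme \<Rightarrow> 'a set \<Rightarrow> 'a \<Rightarrow> 'a \<Rightarrow> bool" where
  "cayley_segment G S g h \<longleftrightarrow> g \<in> carrier G \<and> h \<in> carrier G \<and>
     (g = h \<or> (\<exists>s\<in>S. h = g \<otimes>\<^bsub>G\<^esub> s \<or> g = h \<otimes>\<^bsub>G\<^esub> s))"

definition cayley_points :: "('a, 'm) monoid_scheme \<Rightarrow> 'a set \<Rightarrow> ('a \<Rightarrow> real) set" where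
  "cayley_points G S = {edge_point g h t | g h t. cayley_segment G S g h \<and> 0 \<le> t \<and> t \<le> 1}"

text \<open>A shortest path between two points either stays inside one edge, or leaves the first
  point's edge through an endpoint \<open>g\<close> and enters the second point's edge through an
  endpoint \<open>g'\<close>. Since \<open>edge_point g h t = edge_point h g (1 - t)\<close>, the set below
  covers all choices of endpoints.\<close>

definition cayley_lengths ::
    "('a, 'm) monoid_scheme \<Rightarrow> 'a set \<Rightarrow> ('a \<Rightarrow> real) \<Rightarrow> ('a \<Rightarrow> real) \<Rightarrow> real set" where
  "cayley_lengths G S x y =
     {\<bar>s - t\<bar> | g h s t. cayley_segment G S g h \<and> s \<in> {0..1} \<and> t \<in> {0..1}
        \<and> x = edge_point g h s \<and> y = edge_point g h t}
     \<union> {s + word_dist G S g g' + t | g h s g' h' t.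
        cayley_segment G S g h \<and> cayley_segment G S g' h' \<and> s \<in> {0..1} \<and> t \<in> {0..1}
        \<and> x = edge_point g h s \<and> y = edge_point g' h' t}"

definition cayley_dist ::
    "('a, 'm) monoid_scheme \<Rightarrow> 'a set \<Rightarrow> ('a \<Rightarrow> real) \<Rightarrow> ('a \<Rightarrow> real) \<Rightarrow> real" where
  "cayley_dist G S x y =
     (if x \<in> cayley_points G S \<and> y \<in> cayley_points G S then Inf (cayley_lengths G S x y) else 0)"

context
  fixes G :: "('a, 'm) monoid_scheme" and S
  assumes G: "group G" and S: "finite_generating_set G S"
begin

interpretation group G by (rule G)

interpretation W: Metric_space "carrier G" "word_dist G S" by (rule Metric_space_word_dist[OF G S])

lemma cayley_segment_sym: "cayley_segment G S g h \<longleftrightarrow> cayley_segment G S h g"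
  by (auto simp: cayley_segment_def)

lemma cayley_segment_carrier: "cayley_segment G S g h \<Longrightarrow> g \<in> carrier G \<and> h \<in> carrier G"
  by (auto simp: cayley_segment_def)

lemma cayley_segment_dist: assumes "cayley_segment G S g h" shows "word_dist G S g h \<le> 1"
proof -
  have *: "word_dist G S g (g \<otimes>\<^bsub>G\<^esub> s) \<le> 1" if "s \<in> S" "g \<in> carrier G" for g s
  proof -
    have s: "s \<in> carrier G" using that S by (auto simp: finite_generating_set_def)
    have "inv\<^bsub>G\<^esub> g \<otimes>\<^bsub>G\<^esub> (g \<otimes>\<^bsub>G\<^esub> s) = s" using that s by (simp add: m_assoc[symmetric])
    moreover have "word_length G S s \<le> 1"
      using word_length_le[OF G S, of "[s]"] that s by (auto simp: word_value_def letters_def)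
    ultimately show ?thesis using that s by (simp add: word_dist_def)
  qed
  have c: "g \<in> carrier G" "h \<in> carrier G" using assms by (auto simp: cayley_segment_def)
  consider "g = h" | s where "s \<in> S" "h = g \<otimes>\<^bsub>G\<^esub> s" | s where "s \<in> S" "g = h \<otimes>\<^bsub>G\<^esub> s"
    using assms by (auto simp: cayley_segment_def)
  then show ?thesis
  proof cases
    case 1 then show ?thesis using c by simp
  next
    case 2 then show ?thesis using * c by blast
  next
    case 3 then show ?thesis using *[of _ h] c W.commute[of g h] by simp
  qed
qed

lemma edge_point_swap: "edge_point g h t = edge_point h g (1 - t)"
  by (auto simp: edge_point_def)

lemma edge_point_coords:
  assumes "0 \<le> t" "t \<le> 1"
  shows "edge_point g h t g \<ge> 1 - t" "v \<noteq> g \<Longrightarrow> edge_point g h t v \<le> t"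
    "v \<noteq> g \<Longrightarrow> v \<noteq> h \<Longrightarrow> edge_point g h t v = 0"
  using assms by (auto simp: edge_point_def of_bool_def)

lemma edge_point_simps: "edge_point g h 0 = edge_point g g t" "edge_point g h 1 = edge_point h h t"
  by (auto simp: edge_point_def of_bool_def)

lemma edge_point_vertex_inj: "edge_point g g t = edge_point h h s \<longleftrightarrow> g = h"
  by (auto simp: edge_point_def fun_eq_iff of_bool_def split: if_splits)

lemma edge_point_dist_le:
  assumes "cayley_segment G S g h" "cayley_segment G S a b" "t \<in> {0..1}" "r \<in> {0..1}"
    and eq: "edge_point g h t = edge_point a b r"
  shows "word_dist G S g a \<le> t + r"
proof (cases "g = a")
  case True then show ?thesis using assms cayley_segment_carrier by auto
next
  case False
  have tr: "1 \<le> t + r"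
    using edge_point_coords(1)[of t g h] edge_point_coords(2)[of r g a b] False eq assms by auto
  have c: "g \<in> carrier G" "h \<in> carrier G" "a \<in> carrier G" "b \<in> carrier G"
    using assms cayley_segment_carrier by auto
  consider "r < 1" | "t < 1" | "t = 1" "r = 1" using assms(3,4) by fastforce
  then show ?thesis
  proof cases
    case 1
    then have "a = h"
      using edge_point_coords(1)[of r a b] edge_point_coords(3)[of t a g h] False eq assms by force
    then show ?thesis using cayley_segment_dist[OF assms(1)] tr by simp
  next
    case 2
    then have "g = b"
      using edge_point_coords(1)[of t g h] edge_point_coords(3)[of r g a b] False eq assms by force
    then show ?thesis using cayley_segment_dist[OF assms(2)] tr W.commute[of a b] by simp
  next
    case 3
    then have "h = b" using eq by (metis edge_point_simps(2) edge_point_vertex_inj)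
    then show ?thesis
      using W.triangle[of g h a] cayley_segment_dist[OF assms(1)] cayley_segment_dist[OF assms(2)] W.commute[of a b] c 3 by simp
  qed
qed

lemma cayley_lengths_localI:
  "\<lbrakk>cayley_segment G S g h; s \<in> {0..1}; t \<in> {0..1}; x = edge_point g h s; y = edge_point g h t\<rbrakk> \<Longrightarrow> \<bar>s - t\<bar> \<in> cayley_lengths G S x y"
  unfolding cayley_lengths_def by blast

lemma cayley_lengths_throughI:
  "\<lbrakk>cayley_segment G S g h; cayley_segment G S g' h'; s \<in> {0..1}; t \<in> {0..1};
    x = edge_point g h s; y = edge_point g' h' t\<rbrakk> \<Longrightarrow> s + word_dist G S g g' + t \<in> cayley_lengths G S x y"
  unfolding cayley_lengths_def by blast

lemma cayley_lengthsE:
  assumes "l \<in> cayley_lengths G S x y"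
  obtains (local) g h s t where "cayley_segment G S g h" "s \<in> {0..1}" "t \<in> {0..1}"
      "x = edge_point g h s" "y = edge_point g h t" "l = \<bar>s - t\<bar>"
  | (through) g h s g' h' t where "cayley_segment G S g h" "cayley_segment G S g' h'" "s \<in> {0..1}" "t \<in> {0..1}"
      "x = edge_point g h s" "y = edge_point g' h' t" "l = s + word_dist G S g g' + t"
  using assms unfolding cayley_lengths_def by blast

lemma cayley_lengths_commute_sub: "cayley_lengths G S x y \<subseteq> cayley_lengths G S y x"
proof
  fix l assume "l \<in> cayley_lengths G S x y"
  then show "l \<in> cayley_lengths G S y x"
  proof (cases rule: cayley_lengthsE)
    case (local g h s t)
    then show ?thesis using cayley_lengths_localI[of g h t s y x] by (simp add: abs_minus_commute)
  next
    case (through g h s g' h' t)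
    then show ?thesis using cayley_lengths_throughI[of g' h' g h t s y x] W.commute[of g g'] by (simp add: algebra_simps)
  qed
qed

lemma cayley_lengths_commute: "cayley_lengths G S x y = cayley_lengths G S y x"
  using cayley_lengths_commute_sub by blast

lemma cayley_lengths_coord:
  assumes "l \<in> cayley_lengths G S x y" shows "\<bar>x w - y w\<bar> \<le> l"
  using assms
proof (cases rule: cayley_lengthsE)
  case (local g h s t)
  then show ?thesis by (auto simp: edge_point_def of_bool_def)
next
  case (through g h s g' h' t)
  have 1: "\<bar>edge_point g h s w - of_bool (w = g)\<bar> \<le> s"
    "\<bar>edge_point g' h' t w - of_bool (w = g')\<bar> \<le> t"
    using through by (auto simp: edge_point_def of_bool_def)
  have "\<bar>of_bool (w = g) - of_bool (w = g') :: real\<bar> \<le> word_dist G S g g'"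
  proof (cases "g = g'")
    case False
    have "word_dist G S g g' \<noteq> 0" using False through cayley_segment_carrier W.zero by blast
    then have "1 \<le> word_dist G S g g'" by (auto simp: word_dist_def split: if_splits)
    then show ?thesis by (auto simp: of_bool_def)
  qed simp
  then show ?thesis unfolding through(5-7) using 1 by linarith
qed

lemma cayley_lengths_nonneg: "l \<in> cayley_lengths G S x y \<Longrightarrow> 0 \<le> l"
  using cayley_lengths_coord by (meson abs_ge_zero order_trans)

lemma cayley_lengths_bdd: "bdd_below (cayley_lengths G S x y)"
  using cayley_lengths_nonneg by (meson bdd_below.I)

lemma cayley_lengths_nonempty: "x \<in> cayley_points G S \<Longrightarrow> y \<in> cayley_points G S \<Longrightarrow> cayley_lengths G S x y \<noteq> {}"
  unfolding cayley_points_def cayley_lengths_def by fastforce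

lemma cayley_lengths_local_through:
  assumes gh: "cayley_segment G S g h" and ab: "cayley_segment G S a b" and cd: "cayley_segment G S c d"
    and st: "s \<in> {0..1}" "t \<in> {0..1}" and r: "r \<in> {0..1}" and q: "q \<in> {0..1}"
    and x: "x = edge_point g h s" and y: "edge_point g h t = edge_point a b r" and z: "z = edge_point c d q"
  shows "\<exists>n\<in>cayley_lengths G S x z. n \<le> \<bar>s - t\<bar> + (r + word_dist G S a c + q)"
proof -
  have car: "g \<in> carrier G" "h \<in> carrier G" "a \<in> carrier G" "b \<in> carrier G" "c \<in> carrier G"
    using gh ab cd cayley_segment_carrier by auto
  have key: "\<exists>n\<in>cayley_lengths G S x z. n \<le> \<bar>s - t\<bar> + (r + word_dist G S a c + q)"
    if gh: "cayley_segment G S g h" and st: "s \<in> {0..1}" "t \<in> {0..1}"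
    and x: "x = edge_point g h s" and le: "s + word_dist G S g a \<le> \<bar>s - t\<bar> + r" for g h s t
    using cayley_lengths_throughI[OF gh cd st(1) q x z] W.triangle[of g a c] car cayley_segment_carrier[OF gh] le
    by (intro bexI) auto
  show ?thesis
  proof (cases "g = h")
    case True
    then have xe: "x = edge_point a b r" using x y edge_point_vertex_inj[of g s g t] by simp
    show ?thesis using cayley_lengths_throughI[OF ab cd r q xe z] by (rule bexI[rotated]) simp
  next
    case False
    have swap: "\<bar>(1 - s) - (1 - t)\<bar> = \<bar>s - t\<bar>" by simp
    have x': "x = edge_point h g (1 - s)" using x edge_point_swap by metis
    have y': "edge_point h g (1 - t) = edge_point a b r" using y edge_point_swap by metis
    have gh': "cayley_segment G S h g" using gh cayley_segment_sym by blast
    show ?thesis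
    proof (cases "r < 1")
      case True
      then have "a = g \<or> a = h"
        using edge_point_coords(1)[of r a b] edge_point_coords(3)[of t a g h] y st r by force
      have ev: "edge_point g h t g = 1 - t" "edge_point g h t h = t" using False by (auto simp: edge_point_def)
      have ar: "1 - r \<le> edge_point a b r a" using edge_point_coords(1)[of r a b] r by simp
      show ?thesis using \<open>a = g \<or> a = h\<close>
      proof
        assume a: "a = g"
        have "t \<le> r" using ar ev(1) fun_cong[OF y, of g] unfolding a by linarith
        then show ?thesis using key[OF gh st x] a car by auto
      next
        assume a: "a = h"
        have "1 - t \<le> r" using ar ev(2) fun_cong[OF y, of h] unfolding a by linarith
        then show ?thesis using key[OF gh' _ _ x', of "1 - t"] a car st abs_minus_commute[of s t] by auto
      qed
    next
      case r1: False
      then have r1: "r = 1" using r by auto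
      have yb: "edge_point g h t = edge_point b b 0" using y r1 by (metis edge_point_simps(2))
      have "edge_point g h t g = 1 - t" "edge_point g h t h = t" using False by (auto simp: edge_point_def)
      then have "(b = g \<and> t = 0) \<or> (b = h \<and> t = 1)"
        using yb False by (auto simp: edge_point_def of_bool_def fun_eq_iff split: if_splits)
      then show ?thesis
      proof
        assume "b = g \<and> t = 0"
        then show ?thesis using key[OF gh st x] cayley_segment_dist[OF ab] W.commute[of a b] r1 st by auto
      next
        assume "b = h \<and> t = 1"
        then show ?thesis using key[OF gh' _ _ x', of "1 - t"] cayley_segment_dist[OF ab] W.commute[of a b] r1 st abs_minus_commute[of s t] by auto
      qed
    qed
  qed
qed

lemma cayley_lengths_local_local:
  assumes gh: "cayley_segment G S g h" and ab: "cayley_segment G S a b"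
    and st: "s \<in> {0..1}" "t \<in> {0..1}" and rq: "r \<in> {0..1}" "q \<in> {0..1}"
    and x: "x = edge_point g h s" and y: "edge_point g h t = edge_point a b r" and z: "z = edge_point a b q"
  shows "\<exists>n\<in>cayley_lengths G S x z. n \<le> \<bar>s - t\<bar> + \<bar>r - q\<bar>"
proof (cases "g = h \<or> a = b")
  case True
  then show ?thesis
  proof
    assume "g = h"
    then have xe: "x = edge_point a b r" using x y edge_point_vertex_inj[of g s g t] by simp
    show ?thesis using cayley_lengths_localI[OF ab rq xe z] by (rule bexI[rotated]) simp
  next
    assume "a = b"
    then have ze: "z = edge_point g h t" using z y edge_point_vertex_inj[of a q a r] by simp
    show ?thesis using cayley_lengths_localI[OF gh st x ze] by (rule bexI[rotated]) simp
  qed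
next
  case False
  have gh': "cayley_segment G S h g" and ab': "cayley_segment G S b a" using gh ab cayley_segment_sym by blast+
  have x': "x = edge_point h g (1 - s)" and z': "z = edge_point b a (1 - q)"
    using x z edge_point_swap by metis+
  have car: "g \<in> carrier G" "h \<in> carrier G" "a \<in> carrier G" "b \<in> carrier G"
    using gh ab cayley_segment_carrier by auto
  have st': "1 - s \<in> {0..1}" "1 - t \<in> {0..1}" and rq': "1 - r \<in> {0..1}" "1 - q \<in> {0..1}" using st rq by auto
  have v: "\<And>w. (1 - t) * of_bool (w = g) + t * of_bool (w = h) = (1 - r) * of_bool (w = a) + r * of_bool (w = b)"
    using y by (metis edge_point_def)
  consider "g = a" "h = b" "t = r" | "g = b" "h = a" "t = 1 - r"
    | "t = 0" "r = 0" "g = a" | "t = 0" "r = 1" "g = b" | "t = 1" "r = 0" "h = a" | "t = 1" "r = 1" "h = b"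
    using v[of g] v[of h] v[of a] v[of b] False by (auto simp: of_bool_def split: if_splits)
  then show ?thesis
  proof cases
    case 1 then show ?thesis using cayley_lengths_localI[OF gh st(1) rq(2) x, of z] z by (intro bexI[of _ "\<bar>s - q\<bar>"]) auto
  next
    case 2
    then have "\<bar>s - (1 - q)\<bar> \<in> cayley_lengths G S x z" using cayley_lengths_localI[OF gh st(1) rq'(2) x, of z] z' by blast
    then show ?thesis using 2 by (intro bexI[of _ "\<bar>s - (1 - q)\<bar>"]) auto
  next
    case 3 then show ?thesis using cayley_lengths_throughI[OF gh ab st(1) rq(2) x z] car st rq by (intro bexI) auto
  next
    case 4 then show ?thesis using cayley_lengths_throughI[OF gh ab' st(1) rq'(2) x z'] car st rq by (intro bexI) auto
  next
    case 5 then show ?thesis using cayley_lengths_throughI[OF gh' ab st'(1) rq(2) x' z] car st rq by (intro bexI) auto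
  next
    case 6 then show ?thesis using cayley_lengths_throughI[OF gh' ab' st'(1) rq'(2) x' z'] car st rq by (intro bexI) auto
  qed
qed

lemma cayley_lengths_triangle:
  assumes l: "l \<in> cayley_lengths G S x y" and m: "m \<in> cayley_lengths G S y z"
  shows "\<exists>n\<in>cayley_lengths G S x z. n \<le> l + m"
  using l
proof (cases rule: cayley_lengthsE)
  case l: (local g h s t)
  show ?thesis using m
  proof (cases rule: cayley_lengthsE)
    case m: (local a b r q)
    show ?thesis using cayley_lengths_local_local[of g h a b s t r q x z] l m by auto
  next
    case m: (through a b r c d q)
    show ?thesis using cayley_lengths_local_through[of g h a b c d s t r q x z] l m by auto
  qed
next
  case l: (through g h s g' h' t)
  show ?thesis using m
  proof (cases rule: cayley_lengthsE)
    case m: (local a b r q)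
    show ?thesis using cayley_lengths_local_through[of a b g' h' g h q r t s z x] l m
      W.commute[of g' g] cayley_lengths_commute[of z x] by (auto simp: abs_minus_commute algebra_simps)
  next
    case m: (through a b r c d q)
    have "word_dist G S g' a \<le> t + r" using edge_point_dist_le[of g' h' a b t r] l m by simp
    moreover have "word_dist G S g c \<le> word_dist G S g g' + word_dist G S g' a + word_dist G S a c"
      using W.triangle[of g g' c] W.triangle[of g' a c] l m cayley_segment_carrier by force
    moreover have "s + word_dist G S g c + q \<in> cayley_lengths G S x z" using cayley_lengths_throughI[of g h c d s q x z] l m by blast
    ultimately show ?thesis using l m by (intro bexI[of _ "s + word_dist G S g c + q"]) auto
  qed
qed

lemma Metric_space_cayley: "Metric_space (cayley_points G S) (cayley_dist G S)"
proof
  fix x y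
  show nn: "0 \<le> cayley_dist G S x y" for x y
    using cInf_greatest[OF cayley_lengths_nonempty[of x y] cayley_lengths_nonneg[of _ x y]] by (simp add: cayley_dist_def)
  show "cayley_dist G S x y = cayley_dist G S y x"
    by (simp add: cayley_dist_def cayley_lengths_commute[of x y])
  assume xy: "x \<in> cayley_points G S" "y \<in> cayley_points G S"
  show "cayley_dist G S x y = 0 \<longleftrightarrow> x = y"
  proof
    assume 0: "cayley_dist G S x y = 0"
    have "\<bar>x w - y w\<bar> \<le> cayley_dist G S x y" for w
      using cInf_greatest[OF cayley_lengths_nonempty[OF xy] cayley_lengths_coord[of _ x y w]] xy by (simp add: cayley_dist_def)
    then show "x = y" using 0 by (auto simp: fun_eq_iff)
  next
    assume "x = y"
    obtain g h t where "cayley_segment G S g h" "0 \<le> t" "t \<le> 1" "x = edge_point g h t"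
      using xy by (auto simp: cayley_points_def)
    then have "\<bar>t - t\<bar> \<in> cayley_lengths G S x y" using cayley_lengths_localI[of g h t t x y] \<open>x = y\<close> by simp
    then have "cayley_dist G S x y \<le> 0" using cInf_lower[OF _ cayley_lengths_bdd] xy by (force simp: cayley_dist_def)
    then show "cayley_dist G S x y = 0" using nn[of x y] by linarith
  qed
  fix z assume z: "z \<in> cayley_points G S"
  have "Inf (cayley_lengths G S x z) - m \<le> l" if "l \<in> cayley_lengths G S x y" "m \<in> cayley_lengths G S y z" for l m
    using cayley_lengths_triangle[OF that] cInf_lower[OF _ cayley_lengths_bdd] by (smt (verit))
  then have "Inf (cayley_lengths G S x z) - m \<le> Inf (cayley_lengths G S x y)" if "m \<in> cayley_lengths G S y z" for m
    using that cayley_lengths_nonempty xy by (intro cInf_greatest) auto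
  then have "Inf (cayley_lengths G S x z) - Inf (cayley_lengths G S x y) \<le> m" if "m \<in> cayley_lengths G S y z" for m using that by force
  then have "Inf (cayley_lengths G S x z) - Inf (cayley_lengths G S x y) \<le> Inf (cayley_lengths G S y z)"
    using cayley_lengths_nonempty xy z by (intro cInf_greatest) auto
  then show "cayley_dist G S x z \<le> cayley_dist G S x y + cayley_dist G S y z"
    using xy z by (simp add: cayley_dist_def)
qed

lemma cayley_dist_vertices:
  assumes g: "g \<in> carrier G" and h: "h \<in> carrier G"
  shows "cayley_dist G S (edge_point g g 0) (edge_point h h 0) = word_dist G S g h"
proof -
  have gg: "cayley_segment G S g g" "cayley_segment G S h h" using g h by (auto simp: cayley_segment_def)
  have mem: "edge_point g g 0 \<in> cayley_points G S" "edge_point h h 0 \<in> cayley_points G S"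
    using gg by (force simp: cayley_points_def)+
  have "word_dist G S g h \<in> cayley_lengths G S (edge_point g g 0) (edge_point h h 0)"
    using cayley_lengths_throughI[OF gg, of 0 0] by simp
  moreover have "word_dist G S g h \<le> l" if "l \<in> cayley_lengths G S (edge_point g g 0) (edge_point h h 0)" for l
    using that
  proof (cases rule: cayley_lengthsE)
    case (through a b s c d t)
    have "word_dist G S g a \<le> s" using edge_point_dist_le[OF gg(1), of a b 0 s] through by simp
    moreover have "word_dist G S h c \<le> t" using edge_point_dist_le[OF gg(2), of c d 0 t] through by simp
    ultimately show ?thesis
      using W.triangle[of g a h] W.triangle[of a c h] W.commute[of h c] through cayley_segment_carrier g h by force
  next
    case (local a b s t)
    have "word_dist G S g a \<le> 0 + s" "word_dist G S g b \<le> 0 + (1 - s)"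
      "word_dist G S h a \<le> 0 + t" "word_dist G S h b \<le> 0 + (1 - t)"
      using edge_point_dist_le[OF gg(1) local(1), of 0 s] edge_point_dist_le[OF gg(2) local(1), of 0 t]
        edge_point_dist_le[OF gg(1) _, of b a 0 "1 - s"] edge_point_dist_le[OF gg(2) _, of b a 0 "1 - t"]
        local cayley_segment_sym[of a b] edge_point_swap[of a b] by auto
    show ?thesis
    proof (cases "g = h")
      case True then show ?thesis using local h by simp
    next
      case False
      then have ab: "a \<noteq> b" using local by (metis edge_point_vertex_inj)
      have "1 - s = of_bool (a = g)" "1 - t = of_bool (a = h)" "s = of_bool (b = g)" "t = of_bool (b = h)"
        using ab local(4,5) by (auto simp: edge_point_def of_bool_def fun_eq_iff split: if_splits)
      then show ?thesis using False ab local(1,6) cayley_segment_dist[of a b] W.commute[of a b]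
        by (auto simp: of_bool_def split: if_splits)
    qed
  qed
  ultimately have "Inf (cayley_lengths G S (edge_point g g 0) (edge_point h h 0)) = word_dist G S g h"
    by (intro cInf_eq_minimum)
  then show ?thesis using mem by (simp add: cayley_dist_def)
qed

end

text \<open>The property does not depend on the finite generating set.\<close>

definition thick_bigon_group :: "('a, 'm) monoid_scheme \<Rightarrow> bool" where
  "thick_bigon_group G \<longleftrightarrow>
     (\<exists>S. finite_generating_set G S
        \<and> Metric_space.thick_bigon (cayley_points G S) (cayley_dist G S))"

end

theory Submission
  imports Defs
begin

text \<open>Write a point of \<open>F \<wr> K\<close> as a pair \<open>(c, \<kappa>)\<close> of a lamp configuration \<open>c\<close> and
the position \<open>\<kappa>\<close> of the lamplighter. A leaf is the set of all points with a given configuration; it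
is a copy of \<open>K\<close>. The proof shows that a quasi-isometry \<open>E \<wr> H \<rightarrow> F \<wr> K\<close> sends every leaf into a
bounded neighbourhood of a leaf, and then counts configurations.

\<^bold>\<open>Leaves go to leaves.\<close> Let \<open>q\<close> be the restriction of the quasi-isometry to a leaf, a coarse embedding
\<open>H \<rightarrow> F \<wr> K\<close>. Suppose that the configurations at \<open>q x\<close> and \<open>q y\<close> differ at a position \<open>k\<close>
that is far from the lamplighter at both points. Fix a configuration \<open>s\<close> of all lamps outside a large
ball around \<open>k\<close>, and count along a path from \<open>x\<close> to \<open>y\<close>, with signs, how often the lamp at \<open>k\<close>
acquires its final value while the lamps outside the ball show \<open>s\<close>. Such a count is the integral of a
coarse 1-cocycle (\<open>lamp_cocycle\<close>): while the lamp at \<open>k\<close> is being changed, the lamplighter is near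
\<open>k\<close> and cannot touch the lamps outside the ball. Hence it is invariant under coarse homotopies, as in
\<open>primitive_coarsely_homotopic\<close>. The counts for the various \<open>s\<close> add up to \<open>1\<close>, so for the path
provided by the thick bigon property one of them does not vanish. Let \<open>p\<close> be a point of the path that
contributes to it. Its image has the lamplighter near \<open>k\<close>, so \<open>p\<close> is far from \<open>x\<close> and \<open>y\<close>, and
some coarsely homotopic path avoids a large ball around \<open>p\<close>. It has the same nonzero count, so it too changes the lamp at \<open>k\<close> while the
outside shows \<open>s\<close>. But the points at which this happens have images within bounded distance of
\<open>q p\<close>, a contradiction. So configurations along \<open>q\<close> differ only near the lamplighter
(\<open>lamp_changes_near_endpoints\<close>), and sending the lamplighter off to infinity produces a limit
configuration, the leaf that \<open>q\<close> follows (\<open>image_near_leaf\<close>).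

\<^bold>\<open>Counting.\<close> With a quasi-inverse this yields a bijection \<open>leaf\<close> between the configurations of the two wreath
products (\<open>bij_betw_leaf\<close>). Fix a position \<open>p\<close> in \<open>H\<close>. Changing the lamp at \<open>p\<close> changes the image
configuration only inside one finite set \<open>A\<close> of positions of \<open>K\<close>, the same for all configurations
(\<open>effect_bounded\<close>), because the effect of a change at \<open>p\<close> is not influenced by lamps far from \<open>p\<close>. The
preimage of the set of configurations supported in \<open>A\<close> has \<open>\<bar>F\<bar> ^ \<bar>A\<bar>\<close> elements and is closed under
changes at \<open>p\<close>, so \<open>\<bar>E\<bar>\<close> divides \<open>\<bar>F\<bar> ^ \<bar>A\<bar>\<close> (\<open>card_values_dvd\<close>). Every prime divisor of
\<open>\<bar>E\<bar>\<close> therefore divides \<open>\<bar>F\<bar>\<close>, and the situation is symmetric.\<close>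

section \<open>Coarse cocycles along coarsely homotopic paths\<close>

definition coarse_cocycle :: "'a set \<Rightarrow> ('a \<Rightarrow> 'a \<Rightarrow> real) \<Rightarrow> real \<Rightarrow> ('a \<Rightarrow> 'a \<Rightarrow> real) \<Rightarrow> bool" where
  "coarse_cocycle M d C \<omega> \<longleftrightarrow>
     (\<forall>x\<in>M. \<forall>y\<in>M. \<forall>z\<in>M. d x y \<le> C \<longrightarrow> d y z \<le> C \<longrightarrow> d x z \<le> C \<longrightarrow> \<omega> x y + \<omega> y z = \<omega> x z)"

text \<open>What the thick bigon property says about cocycles, in terms of points only: the chain \<open>z\<close> is a
subdivision of the given path, and a cocycle with nonzero integral along it is nonzero somewhere
on the homotopic path that stays away from \<open>z i\<close>. Unlike paths, this can be transported to any
space that is isometric up to an additive error.\<close>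

definition detour_chain :: "'a set \<Rightarrow> ('a \<Rightarrow> 'a \<Rightarrow> real) \<Rightarrow> real \<Rightarrow> real \<Rightarrow> real \<Rightarrow> 'a \<Rightarrow> 'a \<Rightarrow> bool" where
  "detour_chain M d C R L x y \<longleftrightarrow> (\<exists>z (N::nat).
        z 0 = x \<and> z N = y \<and> (\<forall>i\<le>N. z i \<in> M) \<and> (\<forall>i<N. d (z i) (z (Suc i)) \<le> C) \<and>
        (\<forall>i\<le>N. \<forall>\<omega>. L \<le> d x (z i) \<longrightarrow> L \<le> d y (z i) \<longrightarrow> coarse_cocycle M d C \<omega> \<longrightarrow>
           (\<Sum>j<N. \<omega> (z j) (z (Suc j))) \<noteq> 0 \<longrightarrow>
           (\<exists>u\<in>M. \<exists>w\<in>M. d u w \<le> C \<and> \<omega> u w \<noteq> 0 \<and> R < d (z i) u)))"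

definition detour_property :: "'a set \<Rightarrow> ('a \<Rightarrow> 'a \<Rightarrow> real) \<Rightarrow> bool" where
  "detour_property M d \<longleftrightarrow> (\<exists>C. \<forall>R. \<exists>L. \<forall>x\<in>M. \<forall>y\<in>M. detour_chain M d C R L x y)"

text \<open>A locally defined antiderivative of the cocycle along the path. Its increment replaces the sum over a fine
subdivision, so that independence of the subdivision never has to be discussed.\<close>

definition primitive :: "('a \<Rightarrow> 'a \<Rightarrow> real) \<Rightarrow> (real \<Rightarrow> 'a) \<Rightarrow> (real \<Rightarrow> real) \<Rightarrow> bool" where
  "primitive \<omega> g \<Phi> \<longleftrightarrow>
     (\<exists>\<delta>>0. \<forall>s\<in>{0..1}. \<forall>t\<in>{0..1}. \<bar>s - t\<bar> < \<delta> \<longrightarrow> \<Phi> t - \<Phi> s = \<omega> (g s) (g t))"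

lemma uniformly_locally_constant:
  fixes f :: "real \<Rightarrow> real"
  assumes "\<delta> > 0" "a \<le> b" and f: "\<And>s t. s \<in> {a..b} \<Longrightarrow> t \<in> {a..b} \<Longrightarrow> \<bar>s - t\<bar> < \<delta> \<Longrightarrow> f s = f t"
  shows "f a = f b"
proof (rule connected_local_const[of "{a..b}" a b f])
  show "\<forall>s\<in>{a..b}. \<forall>\<^sub>F t in at s within {a..b}. f s = f t"
  proof
    fix s assume s: "s \<in> {a..b}"
    have "\<forall>t\<in>{a..b}. t \<noteq> s \<and> dist t s < \<delta> \<longrightarrow> f s = f t"
      using f[OF s] by (simp add: dist_real_def abs_minus_commute)
    then show "\<forall>\<^sub>F t in at s within {a..b}. f s = f t"
      unfolding eventually_at using \<open>\<delta> > 0\<close> by blast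
  qed
qed (use assms in auto)

context Metric_space
begin

lemma pathin_in_M: "pathin mtopology g \<Longrightarrow> t \<in> {0..1} \<Longrightarrow> g t \<in> M"
  by (auto simp: pathin_def continuous_map_def)

text \<open>The Heine--Cantor theorem for paths in a metric space, from a Lebesgue number of the cover of \<open>{0..1}\<close> by
preimages of balls.\<close>

lemma pathin_uniformly_continuous:
  assumes g: "pathin mtopology g" and "\<epsilon> > 0"
  shows "\<exists>\<delta>>0. \<forall>s\<in>{0..1}. \<forall>t\<in>{0..1}. \<bar>s - t\<bar> < \<delta> \<longrightarrow> d (g s) (g t) < \<epsilon>"
proof -
  define \<G> where "\<G> = {T. open T \<and> (\<exists>x\<in>{0..1::real}. \<forall>t\<in>{0..1}\<inter>T. g t \<in> mball (g x) (\<epsilon>/2))}"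
  have cov: "{0..1} \<subseteq> \<Union>\<G>"
  proof
    fix x :: real assume x: "x \<in> {0..1}"
    have "openin (top_of_set {0..1}) {t \<in> {0..1}. g t \<in> mball (g x) (\<epsilon>/2)}"
      using openin_continuous_map_preimage[OF g[unfolded pathin_def] openin_mball[of "g x" "\<epsilon>/2"]] by simp
    then obtain T where T: "open T" "{t \<in> {0..1}. g t \<in> mball (g x) (\<epsilon>/2)} = {0..1} \<inter> T"
      unfolding openin_open by blast
    have "x \<in> {t \<in> {0..1}. g t \<in> mball (g x) (\<epsilon>/2)}"
      using x pathin_in_M[OF g x] \<open>\<epsilon> > 0\<close> by simp
    then have "x \<in> T" unfolding T(2) by blast
    moreover have "T \<in> \<G>" unfolding \<G>_def using T x by blast
    ultimately show "x \<in> \<Union>\<G>" by blast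
  qed
  obtain e where e: "0 < e" "\<And>x. x \<in> {0..1} \<Longrightarrow> \<exists>G\<in>\<G>. ball x e \<subseteq> G"
    using Heine_Borel_lemma[of "{0..1::real}" \<G>] cov unfolding \<G>_def by (metis (no_types, lifting) compact_Icc mem_Collect_eq)
  have "d (g s) (g t) < \<epsilon>" if st: "s \<in> {0..1}" "t \<in> {0..1}" "\<bar>s - t\<bar> < e" for s t
  proof -
    obtain G x where G: "ball s e \<subseteq> G" "\<forall>t\<in>{0..1}\<inter>G. g t \<in> mball (g x) (\<epsilon>/2)"
      using e(2)[OF st(1)] unfolding \<G>_def by blast
    have "s \<in> G" "t \<in> G" using G(1) st e(1) by (auto simp: dist_real_def subset_iff)
    then have "g s \<in> mball (g x) (\<epsilon>/2)" "g t \<in> mball (g x) (\<epsilon>/2)" using G(2) st by auto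
    then show ?thesis using triangle[of "g s" "g x" "g t"] commute[of "g s" "g x"] by (auto simp: in_mball)
  qed
  then show ?thesis using e(1) by blast
qed

lemma coarse_cocycle_refl:
  assumes "coarse_cocycle M d C \<omega>" "0 \<le> C" "x \<in> M" shows "\<omega> x x = 0"
proof -
  have "\<omega> x x + \<omega> x x = \<omega> x x" using assms unfolding coarse_cocycle_def by simp
  then show ?thesis by simp
qed

lemma coarse_cocycle_swap:
  assumes "coarse_cocycle M d C \<omega>" "0 \<le> C" "x \<in> M" "y \<in> M" "d x y \<le> C" shows "\<omega> y x = - \<omega> x y"
proof -
  have "\<omega> x y + \<omega> y x = \<omega> x x" using assms commute[of x y] unfolding coarse_cocycle_def by simp
  then show ?thesis using coarse_cocycle_refl[of C \<omega> x] assms by simp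
qed

lemma primitiveI:
  assumes \<omega>: "coarse_cocycle M d C \<omega>" "C > 0" and g: "pathin mtopology g" and "\<delta> > 0"
    and st: "\<And>s t. 0 \<le> s \<Longrightarrow> s \<le> t \<Longrightarrow> t \<le> 1 \<Longrightarrow> t - s < \<delta> \<Longrightarrow> \<Phi> t - \<Phi> s = \<omega> (g s) (g t)"
  shows "primitive \<omega> g \<Phi>"
proof -
  obtain \<delta>' where \<delta>': "\<delta>' > 0" "\<And>s t. s \<in> {0..1} \<Longrightarrow> t \<in> {0..1} \<Longrightarrow> \<bar>s - t\<bar> < \<delta>' \<Longrightarrow> d (g s) (g t) < C"
    using pathin_uniformly_continuous[OF g \<open>C > 0\<close>] by blast
  have "\<Phi> t - \<Phi> s = \<omega> (g s) (g t)" if "s \<in> {0..1}" "t \<in> {0..1}" "\<bar>s - t\<bar> < min \<delta> \<delta>'" for s t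
  proof (cases "s \<le> t")
    case False
    then have "\<Phi> s - \<Phi> t = \<omega> (g t) (g s)" using st[of t s] that by auto
    moreover have "\<omega> (g s) (g t) = - \<omega> (g t) (g s)"
      using coarse_cocycle_swap[OF \<omega>(1), of "g t" "g s"] \<delta>'(2)[of t s] that pathin_in_M[OF g] \<omega>(2) by force
    ultimately show ?thesis by simp
  qed (use st[of s t] that in auto)
  then show ?thesis unfolding primitive_def using \<open>\<delta> > 0\<close> \<delta>'(1) by (metis min_less_iff_conj)
qed

text \<open>Sum the cocycle over the subdivision points before \<open>t\<close> and add its value from the last such point
to \<open>t\<close>. Nearby parameters lie in the same or in adjacent pieces of the subdivision, where the cocycle
identity applies.\<close>

lemma primitive_exists:
  assumes \<omega>: "coarse_cocycle M d C \<omega>" "C > 0" and g: "pathin mtopology g" and N: "N > (0::nat)"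
    and fine: "\<And>s t. s \<in> {0..1} \<Longrightarrow> t \<in> {0..1} \<Longrightarrow> \<bar>s - t\<bar> \<le> 1 / N \<Longrightarrow> d (g s) (g t) \<le> C"
  shows "\<exists>\<Phi>. primitive \<omega> g \<Phi> \<and> \<Phi> 1 - \<Phi> 0 = (\<Sum>i<N. \<omega> (g (i / N)) (g (Suc i / N)))"
proof -
  define n where "n t = nat \<lfloor>t * N\<rfloor>" for t :: real
  define \<Phi> where "\<Phi> t = (\<Sum>i<n t. \<omega> (g (i / N)) (g (Suc i / N))) + \<omega> (g (n t / N)) (g t)" for t
  have coc: "\<omega> (g r) (g s) + \<omega> (g s) (g t) = \<omega> (g r) (g t)"
    if "r \<in> {0..1}" "s \<in> {0..1}" "t \<in> {0..1}" "\<bar>r - s\<bar> \<le> 1/N" "\<bar>s - t\<bar> \<le> 1/N" "\<bar>r - t\<bar> \<le> 1/N" for r s t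
    using \<omega>(1) that fine pathin_in_M[OF g] unfolding coarse_cocycle_def by simp
  have n: "n t / N \<le> t" "t < n t / N + 1 / N" if "0 \<le> t" for t
  proof -
    have "real (n t) \<le> t * N" "t * N < real (n t) + 1"
      using that unfolding n_def by (simp_all add: of_nat_floor)
    then show "n t / N \<le> t" "t < n t / N + 1 / N" using N by (auto simp: field_simps)
  qed
  have "\<Phi> t - \<Phi> s = \<omega> (g s) (g t)" if st: "0 \<le> s" "s \<le> t" "t \<le> 1" "t - s < 1 / N" for s t
  proof -
    have "n s \<le> n t" unfolding n_def using st by (intro nat_mono floor_mono mult_right_mono) auto
    moreover have "n t \<le> Suc (n s)"
    proof -
      have "n t / N < (real (n s) + 2) / N" using n[of s] n[of t] st by (auto simp: add_divide_distrib)
      then show ?thesis using N by (auto simp: divide_less_cancel)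
    qed
    ultimately consider "n t = n s" | "n t = Suc (n s)" by linarith
    then show ?thesis
    proof cases
      case 1
      have "\<omega> (g (n s / N)) (g s) + \<omega> (g s) (g t) = \<omega> (g (n s / N)) (g t)"
        using coc[of "n s / N" s t] n[of s] n[of t] st 1 by auto
      then show ?thesis unfolding \<Phi>_def 1 by simp
    next
      case 2
      have m: "real (Suc (n s)) / N = n s / N + 1 / N" by (simp add: add_divide_distrib)
      have "\<omega> (g (n s / N)) (g s) + \<omega> (g s) (g (Suc (n s) / N)) = \<omega> (g (n s / N)) (g (Suc (n s) / N))"
        using coc[of "n s / N" s "Suc (n s) / N"] n[of s] n[of t] st 2 m by auto
      moreover have "\<omega> (g s) (g (Suc (n s) / N)) + \<omega> (g (Suc (n s) / N)) (g t) = \<omega> (g s) (g t)"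
        using coc[of s "Suc (n s) / N" t] n[of s] n[of t] st 2 m by auto
      ultimately show ?thesis unfolding \<Phi>_def 2 by simp
    qed
  qed
  then have "primitive \<omega> g \<Phi>" using primitiveI[OF \<omega> g, of "1 / N"] N by simp
  moreover have "\<omega> (g 0) (g 0) = 0" "\<omega> (g 1) (g 1) = 0"
    using coarse_cocycle_refl[OF \<omega>(1)] \<omega>(2) pathin_in_M[OF g] by auto
  then have "\<Phi> 1 - \<Phi> 0 = (\<Sum>i<N. \<omega> (g (i / N)) (g (Suc i / N)))"
    unfolding \<Phi>_def n_def using N by simp
  ultimately show ?thesis by blast
qed

text \<open>On a piece of diameter at most \<open>C\<close> the cocycle identity holds globally, so
\<open>\<Phi> t - \<omega> (g a) (g t)\<close> is locally constant in \<open>t\<close>.\<close>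

lemma primitive_small_interval:
  assumes \<omega>: "coarse_cocycle M d C \<omega>" and \<Phi>: "primitive \<omega> g \<Phi>" and g: "pathin mtopology g"
    and ab: "0 \<le> a" "a \<le> b" "b \<le> 1"
    and small: "\<forall>s\<in>{a..b}. \<forall>t\<in>{a..b}. d (g s) (g t) \<le> C"
  shows "\<Phi> b - \<Phi> a = \<omega> (g a) (g b)"
proof -
  obtain \<delta> where \<delta>: "\<delta> > 0" "\<And>s t. s \<in> {0..1} \<Longrightarrow> t \<in> {0..1} \<Longrightarrow> \<bar>s - t\<bar> < \<delta> \<Longrightarrow> \<Phi> t - \<Phi> s = \<omega> (g s) (g t)"
    using \<Phi> unfolding primitive_def by blast
  have "\<Phi> a - \<omega> (g a) (g a) = \<Phi> b - \<omega> (g a) (g b)"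
  proof (rule uniformly_locally_constant[OF \<delta>(1) ab(2), of "\<lambda>t. \<Phi> t - \<omega> (g a) (g t)"])
    fix s t assume st: "s \<in> {a..b}" "t \<in> {a..b}" "\<bar>s - t\<bar> < \<delta>"
    then have "\<omega> (g a) (g s) + \<omega> (g s) (g t) = \<omega> (g a) (g t)"
      using \<omega> small ab pathin_in_M[OF g] unfolding coarse_cocycle_def by simp
    then show "\<Phi> s - \<omega> (g a) (g s) = \<Phi> t - \<omega> (g a) (g t)" using \<delta>(2)[of s t] st ab by auto
  qed
  moreover have "d (g a) (g a) \<le> C" using small ab by simp
  then have "0 \<le> C" by (rule order_trans[OF nonneg])
  then have "\<omega> (g a) (g a) = 0" using coarse_cocycle_refl[OF \<omega>] pathin_in_M[OF g, of a] ab by simp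
  ultimately show ?thesis by simp
qed

text \<open>The replaced and the replacing subpath have the same endpoints and both have diameter at most \<open>C\<close>, so
both contribute the value of the cocycle at these endpoints.\<close>

lemma primitive_coarse_move:
  assumes \<omega>: "coarse_cocycle M d C \<omega>" "C > 0" and move: "coarse_move C g h" and \<Phi>: "primitive \<omega> g \<Phi>"
  shows "\<exists>\<Psi>. primitive \<omega> h \<Psi> \<and> \<Psi> 0 = \<Phi> 0 \<and> \<Psi> 1 = \<Phi> 1"
proof -
  have g: "pathin mtopology g" and h: "pathin mtopology h" using move[unfolded coarse_move_def, THEN conjunct1] move[unfolded coarse_move_def, THEN conjunct2, THEN conjunct1] by -
  obtain a b where ab: "0 \<le> a" "a \<le> b" "b \<le> 1"
    and same': "\<forall>t\<in>{0..1} - {a<..<b}. h t = g t"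
    and small': "\<forall>u \<in> g ` {a..b} \<union> h ` {a..b}. \<forall>v \<in> g ` {a..b} \<union> h ` {a..b}. d u v \<le> C"
    using move[unfolded coarse_move_def, THEN conjunct2, THEN conjunct2] by metis
  have same: "h t = g t" if "t \<in> {0..1}" "t \<notin> {a<..<b}" for t using same' that by simp
  have small: "d (g s) (g t) \<le> C" "d (h s) (h t) \<le> C" if "s \<in> {a..b}" "t \<in> {a..b}" for s t
    using small' that by simp_all
  obtain \<delta> where \<delta>: "\<delta> > 0" "\<And>s t. s \<in> {0..1} \<Longrightarrow> t \<in> {0..1} \<Longrightarrow> \<bar>s - t\<bar> < \<delta> \<Longrightarrow> \<Phi> t - \<Phi> s = \<omega> (g s) (g t)"
    using \<Phi> unfolding primitive_def by blast
  obtain \<delta>' where \<delta>': "\<delta>' > 0" "\<And>s t. s \<in> {0..1} \<Longrightarrow> t \<in> {0..1} \<Longrightarrow> \<bar>s - t\<bar> < \<delta>' \<Longrightarrow> d (h s) (h t) < C"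
    using pathin_uniformly_continuous[OF h \<open>C > 0\<close>] by blast
  \<comment> \<open>The old primitive, rebuilt on the replaced piece from its value at \<open>a\<close>; by \<open>primitive_small_interval\<close> it fits at \<open>b\<close>.\<close>
  define \<Psi> where "\<Psi> t = (if t \<in> {a<..<b} then \<Phi> a + \<omega> (h a) (h t) else \<Phi> t)" for t
  have hab: "h a = g a" "h b = g b" using same ab by auto
  have hM: "h t \<in> M" if "0 \<le> t" "t \<le> 1" for t using pathin_in_M[OF h] that by simp
  have refl: "\<omega> (h a) (h a) = 0" using coarse_cocycle_refl[OF \<omega>(1)] \<omega>(2) hM[of a] ab by simp
  have inside: "\<Psi> t = \<Phi> a + \<omega> (h a) (h t)" if "a \<le> t" "t \<le> b" for t
  proof -
    have "\<Phi> b - \<Phi> a = \<omega> (g a) (g b)"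
      using primitive_small_interval[OF \<omega>(1) \<Phi> g ab] small(1) by blast
    then show ?thesis using that refl hab unfolding \<Psi>_def by (cases "t = a"; cases "t = b") auto
  qed
  have outside: "\<Psi> t = \<Phi> t" if "t \<le> a \<or> b \<le> t" for t using that unfolding \<Psi>_def by auto
  have coc: "\<omega> (h r) (h s) + \<omega> (h s) (h t) = \<omega> (h r) (h t)"
    if "0 \<le> r" "r \<le> 1" "0 \<le> s" "s \<le> 1" "0 \<le> t" "t \<le> 1" "d (h r) (h s) \<le> C" "d (h s) (h t) \<le> C" "d (h r) (h t) \<le> C" for r s t
    using \<omega>(1) that hM unfolding coarse_cocycle_def by simp
  have "primitive \<omega> h \<Psi>"
  proof (rule primitiveI[OF \<omega> h])
    show "0 < min \<delta> \<delta>'" using \<delta>(1) \<delta>'(1) by simp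
    fix s t :: real assume st: "0 \<le> s" "s \<le> t" "t \<le> 1" "t - s < min \<delta> \<delta>'"
    have near: "d (h u) (h v) \<le> C" if "s \<le> u" "u \<le> t" "s \<le> v" "v \<le> t" for u v
      using \<delta>'(2)[of u v] that st by force
    have eq: "\<Phi> v - \<Phi> u = \<omega> (h u) (h v)"
      if "s \<le> u" "u \<le> v" "v \<le> t" "u \<notin> {a<..<b}" "v \<notin> {a<..<b}" for u v
      using \<delta>(2)[of u v] same[of u] same[of v] that st by auto
    consider "s \<notin> {a<..<b}" "t \<notin> {a<..<b}" | "a \<le> s" "t \<le> b" | "s < a" "a < t" "t < b" | "a < s" "s < b" "b < t"
      using st by (smt (verit) greaterThanLessThan_iff)
    then show "\<Psi> t - \<Psi> s = \<omega> (h s) (h t)"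
    proof cases
      case 1 then show ?thesis using eq[of s t] st unfolding \<Psi>_def by auto
    next
      case 2
      then show ?thesis using coc[of a s t] inside[of s] inside[of t] st ab small(2) by simp
    next
      case 3
      then have "\<Phi> a - \<Phi> s = \<omega> (h s) (h a)" "\<omega> (h s) (h a) + \<omega> (h a) (h t) = \<omega> (h s) (h t)"
        using eq[of s a] coc[of s a t] near st ab by auto
      then show ?thesis using outside[of s] inside[of t] 3 by auto
    next
      case 4
      then have "\<Phi> t - \<Phi> b = \<omega> (h b) (h t)" "\<omega> (h s) (h b) + \<omega> (h b) (h t) = \<omega> (h s) (h t)"
        using eq[of b t] coc[of s b t] near st ab by auto
      moreover have "\<omega> (h a) (h s) + \<omega> (h s) (h b) = \<omega> (h a) (h b)"
        using coc[of a s b] 4 st ab small(2) by simp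
      moreover have "\<Phi> b = \<Phi> a + \<omega> (h a) (h b)" using inside[of b] outside[of b] ab by simp
      ultimately show ?thesis using outside[of t] inside[of s] 4 by auto
    qed
  qed
  moreover have "\<Psi> 0 = \<Phi> 0" "\<Psi> 1 = \<Phi> 1" using outside ab by auto
  ultimately show ?thesis by blast
qed

lemma primitive_coarsely_homotopic:
  assumes \<omega>: "coarse_cocycle M d C \<omega>" "C > 0" and "C' \<le> C"
    and hom: "coarsely_homotopic C' g h" and \<Phi>: "primitive \<omega> g \<Phi>"
  shows "\<exists>\<Psi>. primitive \<omega> h \<Psi> \<and> \<Psi> 0 = \<Phi> 0 \<and> \<Psi> 1 = \<Phi> 1"
proof -
  have moves: "(coarse_move C')\<^sup>*\<^sup>* g h" using hom unfolding coarsely_homotopic_def by blast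
  show ?thesis using moves
  proof (induction rule: rtranclp_induct)
    case base then show ?case using \<Phi> by blast
  next
    case (step h h')
    have "coarse_move C h h'" using step.hyps(2) \<open>C' \<le> C\<close> unfolding coarse_move_def by (meson order_trans)
    then show ?case using step.IH primitive_coarse_move[OF \<omega>] by metis
  qed
qed

lemma primitive_not_constant:
  assumes h: "pathin mtopology h" "C > 0" and \<Psi>: "primitive \<omega> h \<Psi>" "\<Psi> 0 \<noteq> \<Psi> 1"
  shows "\<exists>s\<in>{0..1}. \<exists>t\<in>{0..1}. d (h s) (h t) \<le> C \<and> \<omega> (h s) (h t) \<noteq> 0"
proof (rule ccontr)
  assume no: "\<not> ?thesis"
  obtain \<delta> where \<delta>: "\<delta> > 0" "\<And>s t. s \<in> {0..1} \<Longrightarrow> t \<in> {0..1} \<Longrightarrow> \<bar>s - t\<bar> < \<delta> \<Longrightarrow> \<Psi> t - \<Psi> s = \<omega> (h s) (h t)"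
    using \<Psi> unfolding primitive_def by blast
  obtain \<delta>' where \<delta>': "\<delta>' > 0" "\<And>s t. s \<in> {0..1} \<Longrightarrow> t \<in> {0..1} \<Longrightarrow> \<bar>s - t\<bar> < \<delta>' \<Longrightarrow> d (h s) (h t) < C"
    using pathin_uniformly_continuous[OF h] by blast
  have "\<Psi> 0 = \<Psi> 1"
  proof (rule uniformly_locally_constant[of "min \<delta> \<delta>'" 0 1 \<Psi>])
    fix s t :: real assume "s \<in> {0..1}" "t \<in> {0..1}" "\<bar>s - t\<bar> < min \<delta> \<delta>'"
    then show "\<Psi> s = \<Psi> t" using \<delta>(2)[of s t] \<delta>'(2)[of s t] no by force
  qed (use \<delta>(1) \<delta>'(1) in auto)
  then show False using \<Psi>(2) by simp
qed

lemma thick_bigon_imp_detour_property: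
  assumes "thick_bigon" shows "detour_property M d"
proof -
  obtain C0 where C0: "C0 \<ge> 0" and tb: "\<And>R. R \<ge> 0 \<Longrightarrow> \<exists>L\<ge>0. \<forall>x\<in>M. \<forall>y\<in>M.
        \<exists>g. pathin mtopology g \<and> g 0 = x \<and> g 1 = y \<and>
          (\<forall>p \<in> g ` {0..1}. d x p \<ge> L \<and> d y p \<ge> L \<longrightarrow>
             (\<exists>h. pathin mtopology h \<and> h 0 = x \<and> h 1 = y \<and> coarsely_homotopic C0 g h
                \<and> h ` {0..1} \<inter> mcball p R = {}))"
    using assms unfolding thick_bigon_def by blast
  \<comment> \<open>The scale has to be positive for subdivisions of that fineness to exist.\<close>
  define C where "C = C0 + 1"
  have C: "C > 0" "C0 \<le> C" using C0 by (auto simp: C_def)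
  show ?thesis unfolding detour_property_def
  proof (rule exI[of _ C], rule allI)
    fix R
    obtain L where L: "\<forall>x\<in>M. \<forall>y\<in>M.
        \<exists>g. pathin mtopology g \<and> g 0 = x \<and> g 1 = y \<and>
          (\<forall>p \<in> g ` {0..1}. d x p \<ge> L \<and> d y p \<ge> L \<longrightarrow>
             (\<exists>h. pathin mtopology h \<and> h 0 = x \<and> h 1 = y \<and> coarsely_homotopic C0 g h
                \<and> h ` {0..1} \<inter> mcball p (max R 0) = {}))"
      using tb[OF max.cobounded2[of 0 R]] by (elim exE conjE) (rule that)
    show "\<exists>L. \<forall>x\<in>M. \<forall>y\<in>M. detour_chain M d C R L x y"
    proof (rule exI[of _ L], intro ballI)
      fix x y assume xy: "x \<in> M" "y \<in> M"
      obtain g where g: "pathin mtopology g" "g 0 = x" "g 1 = y"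
        and detour: "\<And>p. p \<in> g ` {0..1} \<Longrightarrow> d x p \<ge> L \<Longrightarrow> d y p \<ge> L \<Longrightarrow>
             \<exists>h. pathin mtopology h \<and> h 0 = x \<and> h 1 = y \<and> coarsely_homotopic C0 g h
                \<and> h ` {0..1} \<inter> mcball p (max R 0) = {}"
        using bspec[OF bspec[OF L xy(1)] xy(2)] by metis
      obtain \<delta> where \<delta>: "\<delta> > 0" "\<And>s t. s \<in> {0..1} \<Longrightarrow> t \<in> {0..1} \<Longrightarrow> \<bar>s - t\<bar> < \<delta> \<Longrightarrow> d (g s) (g t) < C"
        using pathin_uniformly_continuous[OF g(1) C(1)] by blast
      obtain N :: nat where N: "N > 0" "1 / N < \<delta>"
        using reals_Archimedean[OF \<delta>(1)] by (metis inverse_eq_divide zero_less_Suc)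
      have fine: "d (g s) (g t) \<le> C" if "s \<in> {0..1}" "t \<in> {0..1}" "\<bar>s - t\<bar> \<le> 1 / N" for s t
        using \<delta>(2)[of s t] N that by force
      define z where "z i = g (real i / N)" for i :: nat
      have in01: "real i / N \<in> {0..1}" if "i \<le> N" for i using that N by simp
      have detected: "\<exists>u\<in>M. \<exists>w\<in>M. d u w \<le> C \<and> \<omega> u w \<noteq> 0 \<and> R < d (z i) u"
        if i: "i \<le> N" "L \<le> d x (z i)" "L \<le> d y (z i)" and \<omega>: "coarse_cocycle M d C \<omega>"
          and sum: "(\<Sum>j<N. \<omega> (z j) (z (Suc j))) \<noteq> 0" for i \<omega>
      proof -
        have zi: "z i \<in> g ` {0..1}" "z i \<in> M" using in01[OF i(1)] pathin_in_M[OF g(1)] unfolding z_def by auto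
        obtain h where h: "pathin mtopology h" "coarsely_homotopic C0 g h" "h ` {0..1} \<inter> mcball (z i) (max R 0) = {}"
          using detour[OF zi(1) i(2,3)] by blast
        have "\<exists>\<Phi>. primitive \<omega> g \<Phi> \<and> \<Phi> 1 - \<Phi> 0 = (\<Sum>j<N. \<omega> (z j) (z (Suc j)))"
          unfolding z_def by (rule primitive_exists[OF \<omega> C(1) g(1) N(1)]) (rule fine)
        then obtain \<Phi> where \<Phi>: "primitive \<omega> g \<Phi>" "\<Phi> 1 - \<Phi> 0 \<noteq> 0"
          using sum by (elim exE conjE) simp
        obtain \<Psi> where \<Psi>: "primitive \<omega> h \<Psi>" "\<Psi> 0 \<noteq> \<Psi> 1"
          using primitive_coarsely_homotopic[OF \<omega> C h(2) \<Phi>(1)] \<Phi>(2) by auto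
        obtain s t where st: "s \<in> {0..1}" "t \<in> {0..1}" "d (h s) (h t) \<le> C" "\<omega> (h s) (h t) \<noteq> 0"
          using primitive_not_constant[OF h(1) C(1) \<Psi>] by blast
        have "h s \<in> M" "h t \<in> M" using pathin_in_M[OF h(1)] st(1,2) by auto
        moreover have "h s \<notin> mcball (z i) (max R 0)" using h(3) st by blast
        ultimately have "R < d (z i) (h s)" using zi(2) by auto
        then show ?thesis using st(3,4) \<open>h s \<in> M\<close> \<open>h t \<in> M\<close> by blast
      qed
      have step: "d (z i) (z (Suc i)) \<le> C" if "i < N" for i
        unfolding z_def using in01[of i] in01[of "Suc i"] that
        by (intro fine) (auto simp: add_divide_distrib)
      show "detour_chain M d C R L x y"
        unfolding detour_chain_def
      proof (intro exI[of _ z] exI[of _ N] conjI allI impI)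
        show "z 0 = x" "z N = y" unfolding z_def using g N by auto
        show "z i \<in> M" if "i \<le> N" for i unfolding z_def using in01[OF that] pathin_in_M[OF g(1)] by blast
      qed (use step detected in blast)+
    qed
  qed
qed

end

section \<open>From Cayley graphs to word metrics\<close>

lemma detour_property_transfer:
  assumes M: "detour_property M d"
    and v: "\<And>x. x \<in> M \<Longrightarrow> v x \<in> Q" and \<iota>: "\<And>q. q \<in> Q \<Longrightarrow> \<iota> q \<in> M" "\<And>q. q \<in> Q \<Longrightarrow> v (\<iota> q) = q"
    and close: "\<And>x y. x \<in> M \<Longrightarrow> y \<in> M \<Longrightarrow> \<bar>d x y - d' (v x) (v y)\<bar> \<le> k"
  shows "detour_property Q d'"
proof -
  obtain C where C: "\<And>R. \<exists>L. \<forall>x\<in>M. \<forall>y\<in>M. detour_chain M d C R L x y"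
    using M unfolding detour_property_def by blast
  have pull: "coarse_cocycle M d C (\<lambda>x y. \<omega> (v x) (v y))" if \<omega>: "coarse_cocycle Q d' (C + k) \<omega>" for \<omega>
    unfolding coarse_cocycle_def
  proof (intro ballI impI)
    fix x y z assume *: "x \<in> M" "y \<in> M" "z \<in> M" "d x y \<le> C" "d y z \<le> C" "d x z \<le> C"
    then have "d' (v x) (v y) \<le> C + k" "d' (v y) (v z) \<le> C + k" "d' (v x) (v z) \<le> C + k"
      using close[of x y] close[of y z] close[of x z] by auto
    then show "\<omega> (v x) (v y) + \<omega> (v y) (v z) = \<omega> (v x) (v z)"
      using \<omega> v * unfolding coarse_cocycle_def by simp
  qed
  show ?thesis unfolding detour_property_def
  proof (rule exI[of _ "C + k"], rule allI)
    fix R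
    obtain L where L: "\<forall>x\<in>M. \<forall>y\<in>M. detour_chain M d C (R + k) L x y"
      using C[of "R + k"] by (elim exE) (rule that)
    show "\<exists>L. \<forall>x\<in>Q. \<forall>y\<in>Q. detour_chain Q d' (C + k) R L x y"
    proof (rule exI[of _ "L + k"], intro ballI)
      fix x y assume xy: "x \<in> Q" "y \<in> Q"
      obtain z N where z: "z 0 = \<iota> x" "z N = \<iota> y" "\<forall>i\<le>N. z i \<in> M" "\<forall>i<N. d (z i) (z (Suc i)) \<le> C"
        and detour: "\<forall>i\<le>N. \<forall>\<omega>. L \<le> d (\<iota> x) (z i) \<longrightarrow> L \<le> d (\<iota> y) (z i) \<longrightarrow> coarse_cocycle M d C \<omega> \<longrightarrow>
           (\<Sum>j<N. \<omega> (z j) (z (Suc j))) \<noteq> 0 \<longrightarrow>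
           (\<exists>u\<in>M. \<exists>w\<in>M. d u w \<le> C \<and> \<omega> u w \<noteq> 0 \<and> R + k < d (z i) u)"
        using bspec[OF bspec[OF L \<iota>(1)[OF xy(1)]] \<iota>(1)[OF xy(2)], unfolded detour_chain_def]
        by (elim exE conjE) (rule that)
      show "detour_chain Q d' (C + k) R (L + k) x y"
        unfolding detour_chain_def
      proof (intro exI[of _ "\<lambda>i. v (z i)"] exI[of _ N] conjI allI impI)
        show "v (z 0) = x" "v (z N) = y" using z \<iota> xy by simp_all
        show "v (z i) \<in> Q" if "i \<le> N" for i using z(3) v that by blast
        show "d' (v (z i)) (v (z (Suc i))) \<le> C + k" if "i < N" for i
          using close[of "z i" "z (Suc i)"] z(3,4) that by force
      next
        fix i \<omega>
        assume i: "i \<le> N" "L + k \<le> d' x (v (z i))" "L + k \<le> d' y (v (z i))"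
          and \<omega>: "coarse_cocycle Q d' (C + k) \<omega>" "(\<Sum>j<N. \<omega> (v (z j)) (v (z (Suc j)))) \<noteq> 0"
        have zi: "z i \<in> M" using z(3) i by blast
        have "L \<le> d (\<iota> x) (z i)" "L \<le> d (\<iota> y) (z i)"
          using close[of "\<iota> x" "z i"] close[of "\<iota> y" "z i"] i \<iota> xy zi by auto
        then have "\<exists>u\<in>M. \<exists>w\<in>M. d u w \<le> C \<and> \<omega> (v u) (v w) \<noteq> 0 \<and> R + k < d (z i) u"
          using detour[rule_format, OF i(1) _ _ pull[OF \<omega>(1)] \<omega>(2)] by blast
        then obtain u w where uw: "u \<in> M" "w \<in> M" "d u w \<le> C" "\<omega> (v u) (v w) \<noteq> 0" "R + k < d (z i) u" by blast
        then have "d' (v u) (v w) \<le> C + k" "R < d' (v (z i)) (v u)"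
          using close[of u w] close[of "z i" u] zi by auto
        then show "\<exists>u\<in>Q. \<exists>w\<in>Q. d' u w \<le> C + k \<and> \<omega> u w \<noteq> 0 \<and> R < d' (v (z i)) u"
          using uw v by blast
      qed
    qed
  qed
qed

text \<open>With the bound \<open>1/2\<close>, rounding every point to such a vertex fixes the vertices themselves, since
distances between vertices are integers.\<close>

lemma cayley_point_near_vertex:
  assumes G: "group G" and S: "finite_generating_set G S" and x: "x \<in> cayley_points G S"
  shows "\<exists>g\<in>carrier G. cayley_dist G S x (edge_point g g 0) \<le> 1/2"
proof -
  have key: ?thesis if "cayley_segment G S g h" "0 \<le> t" "t \<le> 1/2" "x = edge_point g h t" for g h t
  proof -
    have "\<bar>t - 0\<bar> \<in> cayley_lengths G S x (edge_point g g 0)"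
      using that by (intro cayley_lengths_localI[OF G S, of g h]) (auto simp: edge_point_def)
    then have "Inf (cayley_lengths G S x (edge_point g g 0)) \<le> \<bar>t - 0\<bar>"
      by (intro cInf_lower cayley_lengths_bdd[OF G S])
    moreover have "edge_point g g 0 \<in> cayley_points G S"
      using that by (force simp: cayley_points_def cayley_segment_def)
    ultimately show ?thesis using that x by (intro bexI[of _ g]) (auto simp: cayley_dist_def cayley_segment_def)
  qed
  obtain g h t where *: "cayley_segment G S g h" "0 \<le> t" "t \<le> 1" "x = edge_point g h t"
    using x by (auto simp: cayley_points_def)
  show ?thesis
  proof (cases "t \<le> 1/2")
    case False
    then show ?thesis
      using key[of h g "1 - t"] * cayley_segment_sym[OF G S, of g h] edge_point_swap[OF G S, of g h t] by simp
  qed (use key * in blast)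
qed

lemma thick_bigon_group_imp_detour_property:
  assumes G: "group G" and "thick_bigon_group G"
  obtains S where "finite_generating_set G S" "detour_property (carrier G) (word_dist G S)"
proof -
  obtain S where S: "finite_generating_set G S"
    and thick: "Metric_space.thick_bigon (cayley_points G S) (cayley_dist G S)"
    using assms(2) unfolding thick_bigon_group_def by blast
  interpret X: Metric_space "cayley_points G S" "cayley_dist G S" by (rule Metric_space_cayley[OF G S])
  interpret W: Metric_space "carrier G" "word_dist G S" by (rule Metric_space_word_dist[OF G S])
  define \<iota> :: "'a \<Rightarrow> 'a \<Rightarrow> real" where "\<iota> g = edge_point g g 0" for g
  define v where "v x = (SOME g. g \<in> carrier G \<and> cayley_dist G S x (\<iota> g) \<le> 1/2)" for x
  have v: "v x \<in> carrier G" "cayley_dist G S x (\<iota> (v x)) \<le> 1/2" if "x \<in> cayley_points G S" for x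
    using someI_ex[OF cayley_point_near_vertex[OF G S that, unfolded Bex_def]] unfolding v_def \<iota>_def by auto
  have \<iota>: "\<iota> g \<in> cayley_points G S" if "g \<in> carrier G" for g
    unfolding cayley_points_def \<iota>_def cayley_segment_def using that by force
  have dist: "cayley_dist G S (\<iota> g) (\<iota> h) = word_dist G S g h" if "g \<in> carrier G" "h \<in> carrier G" for g h
    using cayley_dist_vertices[OF G S that] unfolding \<iota>_def .
  have "detour_property (carrier G) (word_dist G S)"
  proof (rule detour_property_transfer[OF X.thick_bigon_imp_detour_property[OF thick] v(1) \<iota>])
    show "v (\<iota> g) = g" if g: "g \<in> carrier G" for g
    proof -
      have "word_dist G S g (v (\<iota> g)) \<le> 1/2" using v[OF \<iota>[OF g]] dist g by simp
      then have "word_dist G S g (v (\<iota> g)) = 0" by (auto simp: word_dist_def)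
      then show ?thesis using g v(1)[OF \<iota>[OF g]] by simp
    qed
    show "\<bar>cayley_dist G S x y - word_dist G S (v x) (v y)\<bar> \<le> 1"
      if xy: "x \<in> cayley_points G S" "y \<in> cayley_points G S" for x y
    proof -
      note m = xy \<iota>[OF v(1)[OF xy(1)]] \<iota>[OF v(1)[OF xy(2)]]
      have "cayley_dist G S x y \<le> cayley_dist G S x (\<iota> (v x)) + cayley_dist G S (\<iota> (v x)) (\<iota> (v y)) + cayley_dist G S (\<iota> (v y)) y"
        using X.triangle[of x "\<iota> (v x)" y] X.triangle[of "\<iota> (v x)" "\<iota> (v y)" y] m by linarith
      moreover have "cayley_dist G S (\<iota> (v x)) (\<iota> (v y)) \<le> cayley_dist G S (\<iota> (v x)) x + cayley_dist G S x y + cayley_dist G S y (\<iota> (v y))"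
        using X.triangle[of "\<iota> (v x)" x "\<iota> (v y)"] X.triangle[of x y "\<iota> (v y)"] m by linarith
      ultimately show ?thesis
        using dist[OF v(1)[OF xy(1)] v(1)[OF xy(2)]] v(2)[OF xy(1)] v(2)[OF xy(2)]
          X.commute[of x "\<iota> (v x)"] X.commute[of y "\<iota> (v y)"] by linarith
    qed
  qed
  then show ?thesis using that S by blast
qed

section \<open>Maps into lamplighter spaces\<close>

definition configurations :: "'q set \<Rightarrow> 'v set \<Rightarrow> 'v \<Rightarrow> ('q \<Rightarrow> 'v) set" where
  "configurations Q V e = {c \<in> Q \<rightarrow>\<^sub>E V. finite {x \<in> Q. c x \<noteq> e}}"

lemma configurations_upd:
  assumes "c \<in> configurations Q V e" "p \<in> Q" "v \<in> V"
  shows "c(p := v) \<in> configurations Q V e"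
proof -
  have "{x \<in> Q. (c(p := v)) x \<noteq> e} \<subseteq> insert p {x \<in> Q. c x \<noteq> e}" by auto
  then have "finite {x \<in> Q. (c(p := v)) x \<noteq> e}"
    using assms(1) finite_subset unfolding configurations_def by blast
  moreover have "c(p := v) \<in> Q \<rightarrow>\<^sub>E V"
    using assms by (auto simp: configurations_def PiE_iff extensional_def)
  ultimately show ?thesis by (simp add: configurations_def)
qed

lemma configurations_eqI:
  assumes "c \<in> configurations Q V e" "c' \<in> configurations Q V' e'" "\<And>k. k \<in> Q \<Longrightarrow> c k = c' k"
  shows "c = c'"
  by (rule extensionalityI[of c Q c']) (use assms in \<open>auto simp: configurations_def PiE_iff\<close>)

text \<open>All that is used of a word metric on a wreath product, relative to the metric on the positions. The last
two axioms describe pairs of points at bounded distance: up to a change of the bound this means that the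
lamplighter positions are close and that the configurations differ only near them. In this form the
generating sets of the wreath product and of the base are independent of each other.\<close>

locale lamplighter =
  Pos: Metric_space Q dQ + Pts: Metric_space "configurations Q V e \<times> Q" D
  for Q :: "'q set" and dQ and V :: "'v set" and e and D +
  assumes infinite_positions: "infinite Q"
    and finite_balls: "x \<in> Q \<Longrightarrow> finite {y \<in> Q. dQ x y \<le> r}"
    and finite_values: "finite V" and default_value: "e \<in> V"
    and near_points: "\<exists>\<rho>. \<forall>w\<in>configurations Q V e \<times> Q. \<forall>w'\<in>configurations Q V e \<times> Q. D w w' \<le> r \<longrightarrow>
        dQ (snd w) (snd w') \<le> \<rho> \<and> (\<forall>k\<in>Q. fst w k \<noteq> fst w' k \<longrightarrow> dQ (snd w) k \<le> \<rho>)"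
    and points_near: "\<exists>r. \<forall>w\<in>configurations Q V e \<times> Q. \<forall>w'\<in>configurations Q V e \<times> Q.
        dQ (snd w) (snd w') \<le> \<rho> \<and> (\<forall>k\<in>Q. fst w k \<noteq> fst w' k \<longrightarrow> dQ (snd w) k \<le> \<rho>) \<longrightarrow> D w w' \<le> r"
begin

abbreviation "Conf \<equiv> configurations Q V e"

abbreviation "Points \<equiv> Conf \<times> Q"

definition spread :: "real \<Rightarrow> real" where
  "spread r = (SOME \<rho>. \<forall>w\<in>Points. \<forall>w'\<in>Points. D w w' \<le> r \<longrightarrow>
        dQ (snd w) (snd w') \<le> \<rho> \<and> (\<forall>k\<in>Q. fst w k \<noteq> fst w' k \<longrightarrow> dQ (snd w) k \<le> \<rho>))"

definition reach :: "real \<Rightarrow> real" where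
  "reach \<rho> = (SOME r. \<forall>w\<in>Points. \<forall>w'\<in>Points.
        dQ (snd w) (snd w') \<le> \<rho> \<and> (\<forall>k\<in>Q. fst w k \<noteq> fst w' k \<longrightarrow> dQ (snd w) k \<le> \<rho>) \<longrightarrow> D w w' \<le> r)"

lemma spread:
  assumes "w \<in> Points" "w' \<in> Points" "D w w' \<le> r"
  shows "dQ (snd w) (snd w') \<le> spread r"
    and "k \<in> Q \<Longrightarrow> fst w k \<noteq> fst w' k \<Longrightarrow> dQ (snd w) k \<le> spread r"
  using someI_ex[OF near_points[of r], folded spread_def] assms by blast+

lemma reach:
  assumes "w \<in> Points" "w' \<in> Points" "dQ (snd w) (snd w') \<le> \<rho>"
    and "\<And>k. k \<in> Q \<Longrightarrow> fst w k \<noteq> fst w' k \<Longrightarrow> dQ (snd w) k \<le> \<rho>"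
  shows "D w w' \<le> reach \<rho>"
  using someI_ex[OF points_near[of \<rho>], folded reach_def] assms by blast

lemma finite_difference:
  assumes "c \<in> Conf" "c' \<in> Conf" shows "finite {k \<in> Q. c k \<noteq> c' k}"
proof (rule finite_subset)
  show "{k \<in> Q. c k \<noteq> c' k} \<subseteq> {k \<in> Q. c k \<noteq> e} \<union> {k \<in> Q. c' k \<noteq> e}" by auto
qed (use assms in \<open>auto simp: configurations_def\<close>)

text \<open>The radius \<open>2 * \<rho>\<close> is large enough for a move of the lamplighter that changes the lamp at \<open>k\<close> to
leave the restricted configuration alone, if \<open>\<rho>\<close> bounds how far such a move reaches: it starts within
\<open>\<rho>\<close> of \<open>k\<close> and changes only lamps within \<open>\<rho>\<close> of its start.\<close>

definition outside :: "'q \<Rightarrow> real \<Rightarrow> ('q \<Rightarrow> 'v) \<times> 'q \<Rightarrow> 'q \<Rightarrow> 'v" where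
  "outside k \<rho> w = restrict (fst w) {x \<in> Q. 2 * \<rho> < dQ k x}"

text \<open>The increment of the indicator of ``the lamp at \<open>k\<close> has value \<open>v\<close>'', counted only while the lamps far
from \<open>k\<close> form the pattern \<open>s\<close>. An indicator is used instead of the lamp value because its increments
add up in the commutative group of the reals, even if the group of lamp values is not abelian.\<close>

definition lamp_cocycle :: "'q \<Rightarrow> real \<Rightarrow> 'v \<Rightarrow> ('q \<Rightarrow> 'v) \<Rightarrow> ('q \<Rightarrow> 'v) \<times> 'q \<Rightarrow> ('q \<Rightarrow> 'v) \<times> 'q \<Rightarrow> real" where
  "lamp_cocycle k \<rho> v s w w' =
     (if outside k \<rho> w = s then of_bool (fst w' k = v) - of_bool (fst w k = v) else 0)"

lemma outside_eq:
  assumes "w \<in> Points" "w' \<in> Points" "D w w' \<le> r" "k \<in> Q" "dQ (snd w) k \<le> spread r"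
  shows "outside k (spread r) w = outside k (spread r) w'"
proof -
  have "fst w x = fst w' x" if x: "x \<in> Q" "2 * spread r < dQ k x" for x
  proof (rule ccontr)
    assume "fst w x \<noteq> fst w' x"
    then have "dQ (snd w) x \<le> spread r" using spread(2)[OF assms(1-3) x(1)] by blast
    then show False
      using Pos.triangle[of k "snd w" x] assms Pos.commute[of k "snd w"] x by (auto simp: mem_Times_iff)
  qed
  then show ?thesis unfolding outside_def by (auto simp: fun_eq_iff)
qed

text \<open>If the lamp at \<open>k\<close> has the same value at all three points, every term vanishes. Otherwise one of them has the
lamplighter near \<open>k\<close>, so all three show the same pattern outside and the increments telescope.\<close>

lemma lamp_cocycle:
  assumes "k \<in> Q" shows "coarse_cocycle Points D r (lamp_cocycle k (spread r) v s)"
  unfolding coarse_cocycle_def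
proof (intro ballI impI)
  fix x y z assume p: "x \<in> Points" "y \<in> Points" "z \<in> Points" and r: "D x y \<le> r" "D y z \<le> r" "D x z \<le> r"
  have p': "D y x \<le> r" "D z x \<le> r" "D z y \<le> r"
    using r Pts.commute by metis+
  show "lamp_cocycle k (spread r) v s x y + lamp_cocycle k (spread r) v s y z = lamp_cocycle k (spread r) v s x z"
  proof (cases "fst x k = fst y k \<and> fst y k = fst z k")
    case True then show ?thesis unfolding lamp_cocycle_def by simp
  next
    case False
    then consider "fst x k \<noteq> fst y k" | "fst y k \<noteq> fst z k" by blast
    then have "outside k (spread r) x = outside k (spread r) y"
    proof cases
      case 1
      then show ?thesis using outside_eq[OF p(1,2) r(1) assms] spread(2)[OF p(1,2) r(1) assms] by blast
    next
      case 2
      then show ?thesis using outside_eq[OF p(2,1) p'(1) assms] spread(2)[OF p(2,3) r(2) assms] by simp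
    qed
    then show ?thesis unfolding lamp_cocycle_def by simp
  qed
qed

end

definition controlled :: "'a set \<Rightarrow> ('a \<Rightarrow> 'a \<Rightarrow> real) \<Rightarrow> ('b \<Rightarrow> 'b \<Rightarrow> real) \<Rightarrow> ('a \<Rightarrow> 'b) \<Rightarrow> (real \<Rightarrow> real) \<Rightarrow> bool" where
  "controlled M d d' f \<sigma> \<longleftrightarrow> (\<forall>x\<in>M. \<forall>y\<in>M. \<forall>r. d x y \<le> r \<longrightarrow> d' (f x) (f y) \<le> \<sigma> r)"

text \<open>Together with \<open>controlled\<close> this says that \<open>f\<close> is a coarse embedding. The moduli are explicit parameters so
that a bound can be uniform over a family of maps, here the restrictions of one map to all leaves.\<close>

definition proper :: "'a set \<Rightarrow> ('a \<Rightarrow> 'a \<Rightarrow> real) \<Rightarrow> ('b \<Rightarrow> 'b \<Rightarrow> real) \<Rightarrow> ('a \<Rightarrow> 'b) \<Rightarrow> (real \<Rightarrow> real) \<Rightarrow> bool" where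
  "proper M d d' f \<tau> \<longleftrightarrow> (\<forall>x\<in>M. \<forall>y\<in>M. \<forall>r. d' (f x) (f y) \<le> r \<longrightarrow> d x y \<le> \<tau> r)"

lemma controlledD: "controlled M d d' f \<sigma> \<Longrightarrow> x \<in> M \<Longrightarrow> y \<in> M \<Longrightarrow> d x y \<le> r \<Longrightarrow> d' (f x) (f y) \<le> \<sigma> r"
  unfolding controlled_def by blast

lemma properD: "proper M d d' f \<tau> \<Longrightarrow> x \<in> M \<Longrightarrow> y \<in> M \<Longrightarrow> d' (f x) (f y) \<le> r \<Longrightarrow> d x y \<le> \<tau> r"
  unfolding proper_def by blast

text \<open>A change of a lamp far from both endpoints would give \<open>lamp_cocycle\<close>, pulled back along \<open>q\<close>, a nonzero
integral for some pattern of the outside lamps, and a detour would have to pass through points whose images are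
close to that of the point it avoids. All constants come from \<open>X\<close> and the moduli, so that one bound serves all
leaves.\<close>

lemma (in lamplighter) lamp_changes_near_endpoints:
  assumes X: "detour_property X dX"
  shows "\<exists>\<rho>. \<forall>q. q \<in> X \<rightarrow> Points \<longrightarrow> controlled X dX D q \<sigma> \<longrightarrow> proper X dX D q \<tau> \<longrightarrow>
     (\<forall>x\<in>X. \<forall>y\<in>X. \<forall>k\<in>Q. fst (q x) k \<noteq> fst (q y) k \<longrightarrow> dQ (snd (q x)) k \<le> \<rho> \<or> dQ (snd (q y)) k \<le> \<rho>)"
proof -
  obtain C where C: "\<And>R. \<exists>L. \<forall>x\<in>X. \<forall>y\<in>X. detour_chain X dX C R L x y"
    using X unfolding detour_property_def by blast
  define r where "r = \<sigma> C"
  define \<rho> where "\<rho> = spread r"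
  \<comment> \<open>If two points have the lamplighter within \<open>\<rho>\<close> of \<open>k\<close> and agree outside the ball of radius \<open>2 * \<rho>\<close> around \<open>k\<close>, then everything in which they differ is within \<open>3 * \<rho>\<close> of either lamplighter. A point outside the ball of radius \<open>R\<close> around the other one is too far away for this. The absolute value stands in for \<open>0 \<le> \<rho>\<close>, which is known only once some lamp has been seen to change.\<close>
  define R where "R = \<tau> (reach (3 * \<bar>\<rho>\<bar>))"
  obtain L where L: "\<forall>x\<in>X. \<forall>y\<in>X. detour_chain X dX C R L x y"
    using C[of R] by (elim exE) (rule that)
  show ?thesis
  proof (intro exI[of _ "spread (\<sigma> L) + \<rho>"] allI impI ballI)
    fix q x y k
    assume q: "q \<in> X \<rightarrow> Points" and ctl: "controlled X dX D q \<sigma>" and proper_q: "proper X dX D q \<tau>"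
      and xy: "x \<in> X" "y \<in> X" and k: "k \<in> Q" and differ: "fst (q x) k \<noteq> fst (q y) k"
    have qP: "q u \<in> Points" "snd (q u) \<in> Q" if "u \<in> X" for u using q that by (auto simp: Pi_iff mem_Times_iff)
    have qC: "D (q u) (q w) \<le> r" if "u \<in> X" "w \<in> X" "dX u w \<le> C" for u w
      unfolding r_def by (rule controlledD[OF ctl that])
    obtain z N where z: "z 0 = x" "z N = y" "\<forall>i\<le>N. z i \<in> X" "\<forall>i<N. dX (z i) (z (Suc i)) \<le> C"
      and detour: "\<forall>i\<le>N. \<forall>\<omega>. L \<le> dX x (z i) \<longrightarrow> L \<le> dX y (z i) \<longrightarrow> coarse_cocycle X dX C \<omega> \<longrightarrow>
           (\<Sum>j<N. \<omega> (z j) (z (Suc j))) \<noteq> 0 \<longrightarrow>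
           (\<exists>u\<in>X. \<exists>w\<in>X. dX u w \<le> C \<and> \<omega> u w \<noteq> 0 \<and> R < dX (z i) u)"
      using bspec[OF bspec[OF L xy(1)] xy(2), unfolded detour_chain_def]
      by (elim exE conjE) (rule that)
    define \<omega> where "\<omega> s = (\<lambda>u w. lamp_cocycle k \<rho> (fst (q y) k) s (q u) (q w))" for s
    define out where "out u = outside k \<rho> (q u)" for u
    define \<phi> where "\<phi> u = (of_bool (fst (q u) k = fst (q y) k) :: real)" for u
    have \<omega>_eq: "\<omega> s u w = (if out u = s then \<phi> w - \<phi> u else 0)" for s u w
      unfolding \<omega>_def lamp_cocycle_def out_def \<phi>_def ..
    have cocycle: "coarse_cocycle X dX C (\<omega> s)" for s
      unfolding coarse_cocycle_def \<omega>_def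
    proof (intro ballI impI)
      fix a b c assume abc: "a \<in> X" "b \<in> X" "c \<in> X" "dX a b \<le> C" "dX b c \<le> C" "dX a c \<le> C"
      show "lamp_cocycle k \<rho> (fst (q y) k) s (q a) (q b) + lamp_cocycle k \<rho> (fst (q y) k) s (q b) (q c)
          = lamp_cocycle k \<rho> (fst (q y) k) s (q a) (q c)"
        unfolding \<rho>_def
        by (rule lamp_cocycle[OF k, unfolded coarse_cocycle_def, rule_format, OF qP(1) qP(1) qP(1) qC qC qC])
          (rule abc)+
    qed
    have near: "dQ (snd (q u)) k \<le> \<rho> \<and> out u = s" if "u \<in> X" "w \<in> X" "dX u w \<le> C" "\<omega> s u w \<noteq> 0" for s u w
    proof -
      have "out u = s" "fst (q u) k \<noteq> fst (q w) k" using that(4) unfolding \<omega>_eq \<phi>_def by (auto split: if_splits)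
      then show ?thesis using spread(2)[OF qP(1) qP(1) qC k] that unfolding \<rho>_def by blast
    qed
    \<comment> \<open>Summed over all patterns, each step of the chain is counted exactly once.\<close>
    have total: "(\<Sum>s\<in>(\<lambda>j. out (z j)) ` {..<N}. \<Sum>j<N. \<omega> s (z j) (z (Suc j))) = 1"
    proof -
      have "(\<Sum>s\<in>(\<lambda>j. out (z j)) ` {..<N}. \<Sum>j<N. \<omega> s (z j) (z (Suc j)))
          = (\<Sum>j<N. \<Sum>s\<in>(\<lambda>j. out (z j)) ` {..<N}. \<omega> s (z j) (z (Suc j)))" by (rule sum.swap)
      also have "\<dots> = (\<Sum>j<N. \<phi> (z (Suc j)) - \<phi> (z j))"
        unfolding \<omega>_eq by (intro sum.cong refl) (simp add: sum.delta)
      also have "\<dots> = \<phi> y - \<phi> x" using sum_lessThan_telescope[of "\<lambda>j. \<phi> (z j)" N] z by simp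
      also have "\<dots> = 1" unfolding \<phi>_def using differ by simp
      finally show ?thesis .
    qed
    obtain s where s: "(\<Sum>j<N. \<omega> s (z j) (z (Suc j))) \<noteq> 0"
      using total sum.neutral[of "(\<lambda>j. out (z j)) ` {..<N}" "\<lambda>s. \<Sum>j<N. \<omega> s (z j) (z (Suc j))"] by fastforce
    obtain i where i: "i < N" "\<omega> s (z i) (z (Suc i)) \<noteq> 0"
      using s sum.neutral[of "{..<N}" "\<lambda>j. \<omega> s (z j) (z (Suc j))"] by fastforce
    define p where "p = z i"
    have p: "p \<in> X" "dQ (snd (q p)) k \<le> \<rho>" "out p = s"
      using near[of "z i" "z (Suc i)" s] z(3,4) i unfolding p_def by auto
    have far: "dQ (snd (q u)) k \<le> spread (\<sigma> L) + \<rho>" if "u \<in> X" "dX u p \<le> L" for u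
    proof -
      have "D (q u) (q p) \<le> \<sigma> L" by (rule controlledD[OF ctl that(1) p(1) that(2)])
      then have "dQ (snd (q u)) (snd (q p)) \<le> spread (\<sigma> L)" using spread(1) qP that p(1) by blast
      then show ?thesis using Pos.triangle[of "snd (q u)" "snd (q p)" k] p qP that k by auto
    qed
    show "dQ (snd (q x)) k \<le> spread (\<sigma> L) + \<rho> \<or> dQ (snd (q y)) k \<le> spread (\<sigma> L) + \<rho>"
    proof (rule ccontr)
      assume "\<not> ?thesis"
      then have "L \<le> dX x (z i)" "L \<le> dX y (z i)" using far[OF xy(1)] far[OF xy(2)] unfolding p_def by linarith+
      then obtain u w where uw: "u \<in> X" "w \<in> X" "dX u w \<le> C" "\<omega> s u w \<noteq> 0" "R < dX p u"
        using detour i(1) cocycle s unfolding p_def by (metis less_imp_le)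
      have u: "dQ (snd (q u)) k \<le> \<rho>" "out u = out p" using near[OF uw(1-4)] p by auto
      have \<rho>0: "0 \<le> \<rho>" using u(1) Pos.nonneg order_trans by blast
      have "D (q p) (q u) \<le> reach (3 * \<bar>\<rho>\<bar>)"
      proof (rule reach[OF qP(1)[OF p(1)] qP(1)[OF uw(1)]])
        show "dQ (snd (q p)) (snd (q u)) \<le> 3 * \<bar>\<rho>\<bar>"
          using Pos.triangle[of "snd (q p)" k "snd (q u)"] Pos.commute[of k "snd (q u)"] p u \<rho>0 qP uw k by auto
        fix x assume x: "x \<in> Q" "fst (q p) x \<noteq> fst (q u) x"
        have "dQ k x \<le> 2 * \<rho>"
        proof (rule ccontr)
          assume "\<not> ?thesis"
          then have "out p x = fst (q p) x" "out u x = fst (q u) x" using x unfolding out_def outside_def by auto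
          then show False using u(2) x(2) by simp
        qed
        then show "dQ (snd (q p)) x \<le> 3 * \<bar>\<rho>\<bar>"
          using Pos.triangle[of "snd (q p)" k x] p qP x k by auto
      qed
      then have "dX p u \<le> R" unfolding R_def by (rule properD[OF proper_q p(1) uw(1)])
      then show False using uw(5) by simp
    qed
  qed
qed

text \<open>The limit configuration takes at \<open>k\<close> the value seen from any point whose lamplighter is far from
\<open>k\<close>; by assumption all these points agree there. Such points exist: otherwise all images would lie at bounded
distance of each other, whereas \<open>X\<close> is infinite with finite balls and \<open>q\<close> is proper.\<close>

lemma (in lamplighter) image_near_leaf:
  assumes X: "infinite X" "\<And>x r. x \<in> X \<Longrightarrow> finite {y \<in> X. dX x y \<le> r}" and q: "q \<in> X \<rightarrow> Points"
    and proper_q: "proper X dX D q \<tau>"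
    and \<rho>: "\<And>x y k. x \<in> X \<Longrightarrow> y \<in> X \<Longrightarrow> k \<in> Q \<Longrightarrow> fst (q x) k \<noteq> fst (q y) k \<Longrightarrow>
        dQ (snd (q x)) k \<le> \<rho> \<or> dQ (snd (q y)) k \<le> \<rho>"
  shows "\<exists>c\<in>Conf. \<forall>x\<in>X. \<forall>k\<in>Q. c k \<noteq> fst (q x) k \<longrightarrow> dQ (snd (q x)) k \<le> \<rho>"
proof -
  have qP: "q u \<in> Points" "snd (q u) \<in> Q" "fst (q u) \<in> Conf" if "u \<in> X" for u
    using q that by (auto simp: Pi_iff mem_Times_iff)
  obtain x where x: "x \<in> X" using X(1) by fastforce
  have exists: "\<exists>y\<in>X. \<rho> < dQ (snd (q y)) k" if k: "k \<in> Q" for k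
  proof (rule ccontr)
    assume "\<not> ?thesis"
    then have all: "dQ (snd (q y)) k \<le> \<rho>" if "y \<in> X" for y using that by force
    define r where "r = reach (3 * \<bar>\<rho>\<bar>)"
    have "D (q x) (q y) \<le> r" if y: "y \<in> X" for y
      unfolding r_def
    proof (rule reach[OF qP(1)[OF x] qP(1)[OF y]])
      have xy: "dQ (snd (q x)) (snd (q y)) \<le> 2 * \<rho>"
        using Pos.triangle[of "snd (q x)" k "snd (q y)"] Pos.commute[of k "snd (q y)"] all[OF x] all[OF y] qP x y k by auto
      then show "dQ (snd (q x)) (snd (q y)) \<le> 3 * \<bar>\<rho>\<bar>" by linarith
      fix j assume j: "j \<in> Q" "fst (q x) j \<noteq> fst (q y) j"
      then have "dQ (snd (q x)) j \<le> \<rho> \<or> dQ (snd (q y)) j \<le> \<rho>" using \<rho> x y by blast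
      then show "dQ (snd (q x)) j \<le> 3 * \<bar>\<rho>\<bar>"
        using Pos.triangle[of "snd (q x)" "snd (q y)" j] xy qP x y j(1) by fastforce
    qed
    then have "X \<subseteq> {y \<in> X. dX x y \<le> \<tau> r}" using properD[OF proper_q x] by blast
    then show False using X(1) X(2)[OF x] finite_subset by blast
  qed
  then obtain y where y: "\<And>k. k \<in> Q \<Longrightarrow> y k \<in> X \<and> \<rho> < dQ (snd (q (y k))) k" by metis
  define c where "c = (\<lambda>k\<in>Q. fst (q (y k)) k)"
  have near: "dQ (snd (q u)) k \<le> \<rho>" if "u \<in> X" "k \<in> Q" "c k \<noteq> fst (q u) k" for u k
    using \<rho>[of u "y k" k] y[OF that(2)] that unfolding c_def by force
  have "c \<in> Conf"
  proof -
    have "{k \<in> Q. c k \<noteq> e} \<subseteq> {k \<in> Q. fst (q x) k \<noteq> e} \<union> {k \<in> Q. dQ (snd (q x)) k \<le> \<rho>}"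
      using near[OF x] by fastforce
    moreover have "finite {k \<in> Q. fst (q x) k \<noteq> e}" using qP(3)[OF x] by (simp add: configurations_def)
    ultimately have "finite {k \<in> Q. c k \<noteq> e}" using finite_balls[OF qP(2)[OF x]] finite_subset by blast
    moreover have "c \<in> Q \<rightarrow>\<^sub>E V" unfolding c_def using qP(3) y by (fastforce simp: configurations_def)
    ultimately show ?thesis by (simp add: configurations_def)
  qed
  then show ?thesis using near by blast
qed

section \<open>Coarse equivalences of lamplighter spaces\<close>

lemma supported_configurations_bij:
  assumes "finite A" "A \<subseteq> Q" "e \<in> V"
  shows "bij_betw (\<lambda>c. restrict c A) {c \<in> configurations Q V e. \<forall>x\<in>Q - A. c x = e} (A \<rightarrow>\<^sub>E V)"
proof (rule bij_betw_byWitness[where f' = "\<lambda>g. \<lambda>x\<in>Q. if x \<in> A then g x else e"])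
  let ?S = "{c \<in> configurations Q V e. \<forall>x\<in>Q - A. c x = e}"
  show "\<forall>c\<in>?S. (\<lambda>x\<in>Q. if x \<in> A then restrict c A x else e) = c"
    unfolding configurations_def by (fastforce simp: fun_eq_iff PiE_iff extensional_def)
  show "\<forall>g\<in>A \<rightarrow>\<^sub>E V. restrict (\<lambda>x\<in>Q. if x \<in> A then g x else e) A = g"
    using assms(2) by (fastforce simp: fun_eq_iff PiE_iff extensional_def)
  show "(\<lambda>c. restrict c A) ` ?S \<subseteq> A \<rightarrow>\<^sub>E V"
    using assms(2) by (fastforce simp: configurations_def)
  show "(\<lambda>g. \<lambda>x\<in>Q. if x \<in> A then g x else e) ` (A \<rightarrow>\<^sub>E V) \<subseteq> ?S"
  proof (rule image_subsetI)
    fix g assume g: "g \<in> A \<rightarrow>\<^sub>E V"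
    let ?c = "\<lambda>x\<in>Q. if x \<in> A then g x else e"
    have "finite {x \<in> Q. ?c x \<noteq> e}" by (rule finite_subset[OF _ assms(1)]) auto
    moreover have "?c \<in> Q \<rightarrow>\<^sub>E V" using g assms(3) by auto
    ultimately show "?c \<in> ?S" by (auto simp: configurations_def)
  qed
qed

lemma card_supported_configurations:
  assumes "finite A" "A \<subseteq> Q" "e \<in> V" "finite V"
  shows "card {c \<in> configurations Q V e. \<forall>x\<in>Q - A. c x = e} = card V ^ card A"
    and "finite {c \<in> configurations Q V e. \<forall>x\<in>Q - A. c x = e}"
  using bij_betw_same_card[OF supported_configurations_bij[OF assms(1-3)]]
    bij_betw_finite[OF supported_configurations_bij[OF assms(1-3)]]
    assms by (simp_all add: card_PiE finite_PiE)

text \<open>A coarse equivalence with its coarse inverse. One modulus \<open>\<sigma>\<close> and one constant \<open>b\<close> serve both directions,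
which makes the situation symmetric under exchanging the two maps.\<close>

locale lamplighter_equivalence =
  A: lamplighter Q dQ V e D + B: lamplighter Q' dQ' V' e' D'
  for Q :: "'q set" and dQ and V :: "'v set" and e D
    and Q' :: "'r set" and dQ' and V' :: "'w set" and e' D' +
  fixes f f' \<sigma> b
  assumes f: "f \<in> A.Points \<rightarrow> B.Points" and f': "f' \<in> B.Points \<rightarrow> A.Points"
    and controlled_f: "controlled A.Points D D' f \<sigma>" and controlled_f': "controlled B.Points D' D f' \<sigma>"
    and inverse: "w \<in> A.Points \<Longrightarrow> D w (f' (f w)) \<le> b" and inverse': "w' \<in> B.Points \<Longrightarrow> D' w' (f (f' w')) \<le> b"
    and detour: "detour_property Q dQ" and detour': "detour_property Q' dQ'"
begin

lemma swapped: "lamplighter_equivalence Q' dQ' V' e' D' Q dQ V e D f' f \<sigma> b"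
  by unfold_locales (use f f' controlled_f controlled_f' inverse inverse' detour detour' in auto)

lemma f_mem: "c \<in> A.Conf \<Longrightarrow> x \<in> Q \<Longrightarrow> f (c, x) \<in> B.Points \<and> snd (f (c, x)) \<in> Q'"
  using funcset_mem[OF f, of "(c, x)"] by (simp add: mem_Times_iff)

lemma proper_f: "proper A.Points D D' f (\<lambda>r. \<sigma> r + 2 * b)"
  unfolding proper_def
proof (intro ballI allI impI)
  fix x y r assume xy: "x \<in> A.Points" "y \<in> A.Points" and "D' (f x) (f y) \<le> r"
  moreover have m: "f x \<in> B.Points" "f y \<in> B.Points" using funcset_mem[OF f] xy by simp_all
  ultimately have 1: "D (f' (f x)) (f' (f y)) \<le> \<sigma> r" by (intro controlledD[OF controlled_f'])
  have m': "f' (f x) \<in> A.Points" "f' (f y) \<in> A.Points" using funcset_mem[OF f'] m by simp_all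
  show "D x y \<le> \<sigma> r + 2 * b"
    using A.Pts.triangle[OF xy(1) m'(1) xy(2)] A.Pts.triangle[OF m'(1,2) xy(2)]
      A.Pts.commute[of y "f' (f y)"] inverse[OF xy(1)] inverse[OF xy(2)] 1 by linarith
qed

lemma leaf_exists:
  "\<exists>\<rho>. \<forall>c\<in>A.Conf. \<exists>c'\<in>B.Conf. \<forall>x\<in>Q. \<forall>k\<in>Q'. c' k \<noteq> fst (f (c, x)) k \<longrightarrow> dQ' (snd (f (c, x))) k \<le> \<rho>"
proof -
  define \<sigma>' where "\<sigma>' r = \<sigma> (A.reach r)" for r
  define \<tau>' where "\<tau>' r = A.spread (\<sigma> r + 2 * b)" for r
  obtain \<rho> where \<rho>: "\<And>q x y k. q \<in> Q \<rightarrow> B.Points \<Longrightarrow> controlled Q dQ D' q \<sigma>' \<Longrightarrow> proper Q dQ D' q \<tau>' \<Longrightarrow>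
     x \<in> Q \<Longrightarrow> y \<in> Q \<Longrightarrow> k \<in> Q' \<Longrightarrow> fst (q x) k \<noteq> fst (q y) k \<Longrightarrow> dQ' (snd (q x)) k \<le> \<rho> \<or> dQ' (snd (q y)) k \<le> \<rho>"
    using B.lamp_changes_near_endpoints[OF detour, of \<sigma>' \<tau>'] by blast
  show ?thesis
  proof (intro exI[of _ \<rho>] ballI)
    fix c assume c: "c \<in> A.Conf"
    let ?q = "\<lambda>x. f (c, x)"
    have q: "?q \<in> Q \<rightarrow> B.Points" using f_mem[OF c] by blast
    have "controlled Q dQ D' ?q \<sigma>'"
      unfolding controlled_def \<sigma>'_def
    proof (intro ballI allI impI)
      fix x y r assume xy: "x \<in> Q" "y \<in> Q" "dQ x y \<le> r"
      then have "D (c, x) (c, y) \<le> A.reach r" using c by (intro A.reach) auto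
      then show "D' (f (c, x)) (f (c, y)) \<le> \<sigma> (A.reach r)"
        using xy c by (intro controlledD[OF controlled_f]) auto
    qed
    moreover have proper_q: "proper Q dQ D' ?q \<tau>'"
      unfolding proper_def \<tau>'_def
    proof (intro ballI allI impI)
      fix x y r assume xy: "x \<in> Q" "y \<in> Q" "D' (f (c, x)) (f (c, y)) \<le> r"
      then have "D (c, x) (c, y) \<le> \<sigma> r + 2 * b" using c by (intro properD[OF proper_f]) auto
      then show "dQ x y \<le> A.spread (\<sigma> r + 2 * b)"
        using A.spread(1)[of "(c, x)" "(c, y)"] xy c by auto
    qed
    ultimately show "\<exists>c'\<in>B.Conf. \<forall>x\<in>Q. \<forall>k\<in>Q'. c' k \<noteq> fst (f (c, x)) k \<longrightarrow> dQ' (snd (f (c, x))) k \<le> \<rho>"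
      using B.image_near_leaf[OF A.infinite_positions A.finite_balls q proper_q] \<rho>[OF q] by blast
  qed
qed

definition leaf_radius :: real where
  "leaf_radius = (SOME \<rho>. \<forall>c\<in>A.Conf. \<exists>c'\<in>B.Conf. \<forall>x\<in>Q. \<forall>k\<in>Q'.
     c' k \<noteq> fst (f (c, x)) k \<longrightarrow> dQ' (snd (f (c, x))) k \<le> \<rho>)"

definition leaf :: "('q \<Rightarrow> 'v) \<Rightarrow> 'r \<Rightarrow> 'w" where
  "leaf c = (SOME c'. c' \<in> B.Conf \<and> (\<forall>x\<in>Q. \<forall>k\<in>Q'.
     c' k \<noteq> fst (f (c, x)) k \<longrightarrow> dQ' (snd (f (c, x))) k \<le> leaf_radius))"

lemma leaf:
  assumes "c \<in> A.Conf"
  shows "leaf c \<in> B.Conf"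
    and "x \<in> Q \<Longrightarrow> k \<in> Q' \<Longrightarrow> leaf c k \<noteq> fst (f (c, x)) k \<Longrightarrow> dQ' (snd (f (c, x))) k \<le> leaf_radius"
proof -
  have "\<exists>c'. c' \<in> B.Conf \<and> (\<forall>x\<in>Q. \<forall>k\<in>Q'. c' k \<noteq> fst (f (c, x)) k \<longrightarrow> dQ' (snd (f (c, x))) k \<le> leaf_radius)"
    using bspec[OF someI_ex[OF leaf_exists, folded leaf_radius_def] assms] unfolding Bex_def .
  note * = someI_ex[OF this, folded leaf_def]
  show "leaf c \<in> B.Conf" using * by (rule conjunct1)
  show "x \<in> Q \<Longrightarrow> k \<in> Q' \<Longrightarrow> leaf c k \<noteq> fst (f (c, x)) k \<Longrightarrow> dQ' (snd (f (c, x))) k \<le> leaf_radius"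
    using *[THEN conjunct2] by blast
qed

text \<open>Where the lamplighter is sent when it stands at \<open>x\<close> in the leaf of \<open>c\<close>.\<close>

definition shadow :: "('q \<Rightarrow> 'v) \<Rightarrow> 'q \<Rightarrow> 'r" where
  "shadow c x = snd (f (c, x))"

definition leaf_error :: real where
  "leaf_error = B.reach \<bar>leaf_radius\<bar>"

lemma shadow_mem: "c \<in> A.Conf \<Longrightarrow> x \<in> Q \<Longrightarrow> shadow c x \<in> Q'"
  using f_mem unfolding shadow_def by blast

lemma leaf_point_mem: "c \<in> A.Conf \<Longrightarrow> x \<in> Q \<Longrightarrow> (leaf c, shadow c x) \<in> B.Points"
  using leaf(1) shadow_mem by blast

lemma f_near_leaf:
  assumes c: "c \<in> A.Conf" and x: "x \<in> Q"
  shows "D' (f (c, x)) (leaf c, shadow c x) \<le> leaf_error"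
  unfolding leaf_error_def
proof (rule B.reach)
  show "f (c, x) \<in> B.Points" using f_mem[OF c x] by blast
  show "(leaf c, shadow c x) \<in> B.Points" using leaf_point_mem[OF c x] .
  show "dQ' (snd (f (c, x))) (snd (leaf c, shadow c x)) \<le> \<bar>leaf_radius\<bar>"
    using shadow_mem[OF c x] by (simp add: shadow_def)
  show "dQ' (snd (f (c, x))) k \<le> \<bar>leaf_radius\<bar>" if "k \<in> Q'" "fst (f (c, x)) k \<noteq> fst (leaf c, shadow c x) k" for k
    using leaf(2)[OF c x that(1)] that(2) by force
qed

text \<open>Going forth and back along the leaf of \<open>c\<close> stays close both to that leaf and to the one of \<open>g (leaf c)\<close>.
Leaves of two different configurations are close only near the finitely many lamps in which they differ, and
\<open>Q\<close> is infinite with finite balls. The hypotheses on \<open>g\<close> and \<open>h\<close> describe the leaf map and the shadow of the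
opposite direction; stating them abstractly allows the lemma to be applied in both directions.\<close>

lemma leaf_left_inverse:
  assumes g: "\<And>c'. c' \<in> B.Conf \<Longrightarrow> g c' \<in> A.Conf"
    and h: "\<And>c' y. c' \<in> B.Conf \<Longrightarrow> y \<in> Q' \<Longrightarrow> h c' y \<in> Q"
    and close: "\<And>c' y. c' \<in> B.Conf \<Longrightarrow> y \<in> Q' \<Longrightarrow> D (f' (c', y)) (g c', h c' y) \<le> \<delta>"
    and c: "c \<in> A.Conf"
  shows "g (leaf c) = c"
proof (rule ccontr)
  assume "g (leaf c) \<noteq> c"
  then obtain k where k: "k \<in> Q" "c k \<noteq> g (leaf c) k"
    using configurations_eqI[OF g[OF leaf(1)[OF c]] c] by metis
  let ?K = "b + \<sigma> leaf_error + \<delta>"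
  have "dQ k x \<le> A.spread ?K" if x: "x \<in> Q" for x
  proof -
    let ?w = "f (c, x)" and ?w' = "(leaf c, shadow c x)"
    have m: "(c, x) \<in> A.Points" "?w \<in> B.Points" "?w' \<in> B.Points"
      using c x f_mem[OF c x] leaf_point_mem[OF c x] by simp_all
    have m': "f' ?w \<in> A.Points" "f' ?w' \<in> A.Points" "(g (leaf c), h (leaf c) (shadow c x)) \<in> A.Points"
      using funcset_mem[OF f' m(2)] funcset_mem[OF f' m(3)] g[OF leaf(1)[OF c]] h[OF leaf(1)[OF c] shadow_mem[OF c x]]
      by simp_all
    have "D (f' ?w) (f' ?w') \<le> \<sigma> leaf_error"
      by (rule controlledD[OF controlled_f' m(2,3) f_near_leaf[OF c x]])
    then have "D (c, x) (g (leaf c), h (leaf c) (shadow c x)) \<le> ?K"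
      using A.Pts.triangle[OF m(1) m'(1) m'(3)] A.Pts.triangle[OF m'] inverse[OF m(1)]
        close[OF leaf(1)[OF c] shadow_mem[OF c x]] by linarith
    then have "dQ x k \<le> A.spread ?K" using A.spread(2)[OF m(1) m'(3) _ k(1)] k(2) by simp
    then show ?thesis using A.Pos.commute[of x k] by simp
  qed
  then have "Q \<subseteq> {x \<in> Q. dQ k x \<le> A.spread ?K}" by blast
  then show False using A.finite_balls[OF k(1)] A.infinite_positions finite_subset by blast
qed

lemma bij_betw_leaf: "bij_betw leaf A.Conf B.Conf"
proof -
  interpret S: lamplighter_equivalence Q' dQ' V' e' D' Q dQ V e D f' f \<sigma> b by (rule swapped)
  show ?thesis
  proof (rule bij_betw_byWitness[where f' = S.leaf])
    show "\<forall>c\<in>A.Conf. S.leaf (leaf c) = c"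
      using leaf_left_inverse[OF S.leaf(1) S.shadow_mem S.f_near_leaf] by blast
    show "\<forall>c\<in>B.Conf. leaf (S.leaf c) = c"
      using S.leaf_left_inverse[OF leaf(1) shadow_mem f_near_leaf] by blast
  qed (use leaf(1) S.leaf(1) in auto)
qed

text \<open>Configurations that agree off \<open>a\<close> have leaves that meet, up to bounded distance, where the lamplighter stands
at \<open>a\<close>. The images of these two points are close as well, and near them the lamplighter of the target can
change only nearby lamps.\<close>

lemma leaf_change_local:
  "\<exists>\<rho>. \<forall>c\<in>A.Conf. \<forall>c'\<in>A.Conf. \<forall>a\<in>Q. (\<forall>k\<in>Q. k \<noteq> a \<longrightarrow> c k = c' k) \<longrightarrow>
     (\<forall>k\<in>Q'. leaf c k \<noteq> leaf c' k \<longrightarrow> dQ' (shadow c a) k \<le> \<rho>)"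
proof (intro exI ballI impI)
  fix c c' a k
  assume c: "c \<in> A.Conf" "c' \<in> A.Conf" and a: "a \<in> Q" and agree: "\<forall>k\<in>Q. k \<noteq> a \<longrightarrow> c k = c' k"
    and k: "k \<in> Q'" "leaf c k \<noteq> leaf c' k"
  let ?r = "\<sigma> (A.reach 0) + 2 * leaf_error"
  have "D (c, a) (c', a) \<le> A.reach 0"
    using c a agree by (intro A.reach) auto
  then have 1: "D' (f (c, a)) (f (c', a)) \<le> \<sigma> (A.reach 0)"
    using c a by (intro controlledD[OF controlled_f]) auto
  have m: "f (c, a) \<in> B.Points" "f (c', a) \<in> B.Points" using f_mem[OF c(1) a] f_mem[OF c(2) a] by simp_all
  note m' = leaf_point_mem[OF c(1) a] leaf_point_mem[OF c(2) a]
  have "D' (leaf c, shadow c a) (leaf c', shadow c' a) \<le> ?r"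
    using B.Pts.triangle[OF m'(1) m(1) m'(2)] B.Pts.triangle[OF m m'(2)] 1
      f_near_leaf[OF c(1) a] f_near_leaf[OF c(2) a] B.Pts.commute[of "f (c, a)" "(leaf c, shadow c a)"] by linarith
  then show "dQ' (shadow c a) k \<le> B.spread ?r" using B.spread(2)[OF m' _ k(1)] k(2) by simp
qed

lemma shadow_proper:
  "\<exists>s. \<forall>c\<in>A.Conf. \<forall>x\<in>Q. \<forall>y\<in>Q. dQ' (shadow c x) (shadow c y) \<le> r \<longrightarrow> dQ x y \<le> s"
proof (intro exI ballI impI)
  fix c x y assume c: "c \<in> A.Conf" and xy: "x \<in> Q" "y \<in> Q" and r: "dQ' (shadow c x) (shadow c y) \<le> r"
  let ?r = "B.reach r + 2 * leaf_error"
  have m: "f (c, x) \<in> B.Points" "f (c, y) \<in> B.Points" using f_mem[OF c xy(1)] f_mem[OF c xy(2)] by simp_all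
  note m' = leaf_point_mem[OF c xy(1)] leaf_point_mem[OF c xy(2)]
  have "D' (leaf c, shadow c x) (leaf c, shadow c y) \<le> B.reach r"
    using m' r by (intro B.reach) auto
  then have "D' (f (c, x)) (f (c, y)) \<le> ?r"
    using B.Pts.triangle[OF m(1) m'(1) m(2)] B.Pts.triangle[OF m' m(2)]
      f_near_leaf[OF c xy(1)] f_near_leaf[OF c xy(2)] B.Pts.commute[of "f (c, y)" "(leaf c, shadow c y)"] by linarith
  then have "D (c, x) (c, y) \<le> \<sigma> ?r + 2 * b" using c xy by (intro properD[OF proper_f]) auto
  then show "dQ x y \<le> A.spread (\<sigma> ?r + 2 * b)" using A.spread(1)[of "(c, x)" "(c, y)"] c xy by simp
qed

definition effect :: "'q \<Rightarrow> 'v \<Rightarrow> ('q \<Rightarrow> 'v) \<Rightarrow> 'r set" where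
  "effect p v c = {k \<in> Q'. leaf c k \<noteq> leaf (c(p := v)) k}"

text \<open>Consider the square of configurations obtained by independently changing the lamps at \<open>p\<close> and at \<open>a\<close>. Its
two sides in direction \<open>p\<close> alter the image near the shadow of \<open>p\<close>, the two in direction \<open>a\<close> near the
shadow of \<open>a\<close>. If \<open>a\<close> is far from \<open>p\<close> these regions are disjoint, so opposite sides in direction \<open>p\<close> have
exactly the same effect.\<close>

lemma effect_ignores_far_lamps:
  "\<exists>s. \<forall>c\<in>A.Conf. \<forall>c'\<in>A.Conf. \<forall>a\<in>Q. \<forall>p\<in>Q. \<forall>v\<in>V.
     (\<forall>k\<in>Q. k \<noteq> a \<longrightarrow> c k = c' k) \<longrightarrow> s < dQ p a \<longrightarrow> effect p v c = effect p v c'"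
proof -
  obtain \<rho> where "\<forall>c\<in>A.Conf. \<forall>c'\<in>A.Conf. \<forall>a\<in>Q. (\<forall>k\<in>Q. k \<noteq> a \<longrightarrow> c k = c' k) \<longrightarrow>
     (\<forall>k\<in>Q'. leaf c k \<noteq> leaf c' k \<longrightarrow> dQ' (shadow c a) k \<le> \<rho>)"
    using leaf_change_local by (elim exE) (rule that)
  note \<rho> = this[rule_format]
  obtain s where s: "\<And>c x y. c \<in> A.Conf \<Longrightarrow> x \<in> Q \<Longrightarrow> y \<in> Q \<Longrightarrow> dQ' (shadow c x) (shadow c y) \<le> 2 * \<rho> \<Longrightarrow> dQ x y \<le> s"
    using shadow_proper[of "2 * \<rho>"] by blast
  have separated: "\<not> (dQ' (shadow c p) k \<le> \<rho> \<and> dQ' (shadow c a) k \<le> \<rho>)"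
    if "c \<in> A.Conf" "p \<in> Q" "a \<in> Q" "k \<in> Q'" "s < dQ p a" for c p a k
  proof
    assume *: "dQ' (shadow c p) k \<le> \<rho> \<and> dQ' (shadow c a) k \<le> \<rho>"
    have "dQ' (shadow c p) (shadow c a) \<le> 2 * \<rho>"
      using * B.Pos.triangle[of "shadow c p" k "shadow c a"] B.Pos.commute[of k "shadow c a"] shadow_mem that by force
    then show False using s[of c p a] that by simp
  qed
  have sub: "effect p v c \<subseteq> effect p v c'"
    if c: "c \<in> A.Conf" "c' \<in> A.Conf" and a: "a \<in> Q" and p: "p \<in> Q" and v: "v \<in> V"
      and agree: "\<forall>k\<in>Q. k \<noteq> a \<longrightarrow> c k = c' k" and far: "s < dQ p a" for c c' a p v
  proof
    fix k assume "k \<in> effect p v c"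
    then have k: "k \<in> Q'" "leaf c k \<noteq> leaf (c(p := v)) k" unfolding effect_def by auto
    have u: "c(p := v) \<in> A.Conf" "c'(p := v) \<in> A.Conf"
      using configurations_upd[OF c(1) p v] configurations_upd[OF c(2) p v] .
    have "dQ' (shadow c p) k \<le> \<rho>" using \<rho>[OF c(1) u(1) p _ k] by simp
    then have "\<not> dQ' (shadow c a) k \<le> \<rho>" using separated[OF c(1) p a k(1) far] by simp
    then have "leaf c k = leaf c' k" using \<rho>[OF c a _ k(1)] agree by metis
    moreover have "dQ' (shadow (c(p := v)) p) k \<le> \<rho>" using \<rho>[OF u(1) c(1) p _ k(1)] k(2) by simp
    then have "\<not> dQ' (shadow (c(p := v)) a) k \<le> \<rho>" using separated[OF u(1) p a k(1) far] by simp
    then have "leaf (c(p := v)) k = leaf (c'(p := v)) k" using \<rho>[OF u a _ k(1)] agree by (metis fun_upd_apply)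
    ultimately show "k \<in> effect p v c'" unfolding effect_def using k by simp
  qed
  show ?thesis
  proof (intro exI[of _ s] ballI impI subset_antisym)
    fix c c' a p v assume *: "c \<in> A.Conf" "c' \<in> A.Conf" "a \<in> Q" "p \<in> Q" "v \<in> V"
      "\<forall>k\<in>Q. k \<noteq> a \<longrightarrow> c k = c' k" "s < dQ p a"
    show "effect p v c \<subseteq> effect p v c'" by (rule sub[OF *])
    show "effect p v c' \<subseteq> effect p v c" by (rule sub[OF *(2,1,3-5) _ *(7)]) (use *(6) in simp)
  qed
qed

text \<open>Switching off one by one the lamps far from \<open>p\<close> leaves the effect unchanged. So only the finitely many
configurations supported near \<open>p\<close> contribute, each with a finite effect.\<close>

lemma effect_bounded:
  assumes p: "p \<in> Q"
  shows "\<exists>A. finite A \<and> A \<subseteq> Q' \<and> (\<forall>c\<in>A.Conf. \<forall>v\<in>V. effect p v c \<subseteq> A)"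
proof -
  obtain s where s: "\<And>c c' a v. c \<in> A.Conf \<Longrightarrow> c' \<in> A.Conf \<Longrightarrow> a \<in> Q \<Longrightarrow> v \<in> V \<Longrightarrow>
     \<forall>k\<in>Q. k \<noteq> a \<longrightarrow> c k = c' k \<Longrightarrow> s < dQ p a \<Longrightarrow> effect p v c = effect p v c'"
    using effect_ignores_far_lamps p by blast
  define Near where "Near = {x \<in> Q. dQ p x \<le> s}"
  define Local where "Local = {c \<in> A.Conf. \<forall>x\<in>Q - Near. c x = e}"
  have Near: "finite Near" "Near \<subseteq> Q" unfolding Near_def using A.finite_balls[OF p] by auto
  have reduce: "\<exists>c0\<in>Local. \<forall>v\<in>V. effect p v c = effect p v c0" if "c \<in> A.Conf" for c
    using that
  proof (induction "card {x \<in> Q - Near. c x \<noteq> e}" arbitrary: c rule: less_induct)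
    case less
    show ?case
    proof (cases "c \<in> Local")
      case False
      then obtain a where a: "a \<in> Q" "a \<notin> Near" "c a \<noteq> e" unfolding Local_def using less.prems by blast
      let ?c = "c(a := e)"
      have c: "?c \<in> A.Conf" using configurations_upd[OF less.prems a(1) A.default_value] .
      have "finite {x \<in> Q - Near. c x \<noteq> e}"
        by (rule finite_subset[of _ "{x \<in> Q. c x \<noteq> e}"]) (use less.prems in \<open>auto simp: configurations_def\<close>)
      moreover have "{x \<in> Q - Near. ?c x \<noteq> e} = {x \<in> Q - Near. c x \<noteq> e} - {a}" by auto
      ultimately have "card {x \<in> Q - Near. ?c x \<noteq> e} < card {x \<in> Q - Near. c x \<noteq> e}"
        using a card_Diff1_less[of "{x \<in> Q - Near. c x \<noteq> e}" a] by simp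
      then obtain c0 where "c0 \<in> Local" "\<forall>v\<in>V. effect p v ?c = effect p v c0" using less.hyps[OF _ c] by blast
      moreover have "effect p v c = effect p v ?c" if "v \<in> V" for v
        using s[OF less.prems c a(1) that] a unfolding Near_def by auto
      ultimately show ?thesis by auto
    qed blast
  qed
  let ?A = "\<Union>c\<in>Local. \<Union>v\<in>V. effect p v c"
  have "finite Local"
    unfolding Local_def by (rule card_supported_configurations(2)[OF Near A.default_value A.finite_values])
  moreover have "finite (effect p v c)" if "c \<in> Local" "v \<in> V" for c v
  proof -
    have c: "c \<in> A.Conf" using that(1) unfolding Local_def by simp
    show ?thesis unfolding effect_def
      by (rule B.finite_difference[OF leaf(1)[OF c] leaf(1)[OF configurations_upd[OF c p that(2)]]])
  qed
  ultimately have "finite ?A" using A.finite_values by blast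
  moreover have "?A \<subseteq> Q'" unfolding effect_def by blast
  moreover have "\<forall>c\<in>A.Conf. \<forall>v\<in>V. effect p v c \<subseteq> ?A"
  proof (intro ballI)
    fix c v assume c: "c \<in> A.Conf" and v: "v \<in> V"
    obtain c0 where c0: "c0 \<in> Local" "effect p v c = effect p v c0" using reduce[OF c] v by auto
    show "effect p v c \<subseteq> ?A" unfolding c0(2) using c0(1) v by (auto intro!: bexI[of _ c0] bexI[of _ v])
  qed
  ultimately show ?thesis by (intro exI[of _ ?A] conjI)
qed

text \<open>The configurations whose image is supported in the set \<open>A\<close> from \<open>effect_bounded\<close> are as numerous as
the configurations supported in \<open>A\<close>. Resetting the lamp at \<open>p\<close> stays among them, so they fall into
classes of \<open>card V\<close> elements, each with a single member that has the default value at \<open>p\<close>.\<close>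

lemma card_values_dvd: "\<exists>n. card V dvd card V' ^ n"
proof -
  obtain p where p: "p \<in> Q" using A.infinite_positions by fastforce
  obtain A where A: "finite A" "A \<subseteq> Q'" and effect: "\<And>c v. c \<in> A.Conf \<Longrightarrow> v \<in> V \<Longrightarrow> effect p v c \<subseteq> A"
    using effect_bounded[OF p] by blast
  define T where "T = {c \<in> B.Conf. \<forall>x\<in>Q' - A. c x = e'}"
  define S where "S = {c \<in> A.Conf. leaf c \<in> T}"
  have "leaf ` S = T"
    using bij_betw_leaf unfolding S_def T_def bij_betw_def by (auto simp: image_iff)
  moreover have "inj_on leaf S" using bij_betw_leaf unfolding S_def bij_betw_def by (auto intro: inj_on_subset)
  ultimately have "card S = card T" using card_image by metis
  also have "\<dots> = card V' ^ card A"
    unfolding T_def by (rule card_supported_configurations(1)[OF A B.default_value B.finite_values])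
  finally have S: "card S = card V' ^ card A" .
  have closed: "c(p := v) \<in> S" if "c \<in> S" "v \<in> V" for c v
  proof -
    have c: "c \<in> A.Conf" "c(p := v) \<in> A.Conf" using that configurations_upd[OF _ p] unfolding S_def by auto
    have "leaf (c(p := v)) x = e'" if "x \<in> Q' - A" for x
      using effect[OF c(1) \<open>v \<in> V\<close>] that \<open>c \<in> S\<close> unfolding effect_def S_def T_def by auto
    then show ?thesis using c leaf(1) unfolding S_def T_def by blast
  qed
  have val: "c p \<in> V" if "c \<in> S" for c using that p unfolding S_def configurations_def by blast
  have "bij_betw (\<lambda>(c, v). c(p := v)) ({c \<in> S. c p = e} \<times> V) S"
  proof (rule bij_betw_byWitness[where f' = "\<lambda>c. (c(p := e), c p)"])
    show "\<forall>cv\<in>{c \<in> S. c p = e} \<times> V. (\<lambda>c. (c(p := e), c p)) (case cv of (c, v) \<Rightarrow> c(p := v)) = cv"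
      by (auto simp: fun_upd_idem)
    show "(\<lambda>c. (c(p := e), c p)) ` S \<subseteq> {c \<in> S. c p = e} \<times> V"
      using closed[OF _ A.default_value] val by auto
  qed (use closed in auto)
  from bij_betw_same_card[OF this] have "card S = card {c \<in> S. c p = e} * card V"
    by (simp add: card_cartesian_product)
  then have "card V dvd card V' ^ card A" using S by (metis dvd_triv_right)
  then show ?thesis by blast
qed

end

section \<open>Wreath products\<close>

lemma finite_word_length_ball:
  assumes G: "group G" and S: "finite_generating_set G S"
  shows "finite {g \<in> carrier G. real (word_length G S g) \<le> r}"
proof (rule finite_subset)
  let ?W = "{w. set w \<subseteq> letters G S \<and> length w \<le> nat \<lfloor>r\<rfloor>}"
  show "{g \<in> carrier G. real (word_length G S g) \<le> r} \<subseteq> word_value G ` ?W"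
  proof
    fix g assume g: "g \<in> {g \<in> carrier G. real (word_length G S g) \<le> r}"
    then obtain w where "length w = word_length G S g" "set w \<subseteq> letters G S" "word_value G w = g"
      using word_length_witness[OF G S] by blast
    then show "g \<in> word_value G ` ?W" using g by (intro image_eqI[of _ _ w]) (auto simp: le_nat_floor)
  qed
  have "finite (letters G S)" using S by (simp add: letters_def finite_generating_set_def)
  then show "finite (word_value G ` ?W)" by (intro finite_imageI finite_lists_length_le)
qed

lemma finite_word_dist_ball:
  assumes G: "group G" and S: "finite_generating_set G S" and x: "x \<in> carrier G"
  shows "finite {y \<in> carrier G. word_dist G S x y \<le> r}"
proof (rule finite_subset)
  interpret group G by fact
  show "{y \<in> carrier G. word_dist G S x y \<le> r}
      \<subseteq> (\<lambda>g. x \<otimes>\<^bsub>G\<^esub> g) ` {g \<in> carrier G. real (word_length G S g) \<le> r}"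
  proof
    fix y assume "y \<in> {y \<in> carrier G. word_dist G S x y \<le> r}"
    then show "y \<in> (\<lambda>g. x \<otimes>\<^bsub>G\<^esub> g) ` {g \<in> carrier G. real (word_length G S g) \<le> r}"
      using x by (intro image_eqI[of _ _ "inv\<^bsub>G\<^esub> x \<otimes>\<^bsub>G\<^esub> y"]) (auto simp: word_dist_def m_assoc[symmetric])
  qed
  show "finite ((\<lambda>g. x \<otimes>\<^bsub>G\<^esub> g) ` {g \<in> carrier G. real (word_length G S g) \<le> r})"
    by (rule finite_imageI[OF finite_word_length_ball[OF G S]])
qed

lemma carrier_wreath_product:
  assumes "group E"
  shows "carrier (wreath_product E H) = configurations (carrier H) (carrier E) \<one>\<^bsub>E\<^esub> \<times> carrier H"
  using assms by (simp add: wreath_product_def configurations_def carrier_sum_group)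

lemma mult_wreath_product:
  assumes "group H" "g \<in> carrier H"
  shows "(a, g) \<otimes>\<^bsub>wreath_product E H\<^esub> (b, h)
    = (\<lambda>x\<in>carrier H. a x \<otimes>\<^bsub>E\<^esub> b (inv\<^bsub>H\<^esub> g \<otimes>\<^bsub>H\<^esub> x), g \<otimes>\<^bsub>H\<^esub> h)"
  by (auto simp: wreath_product_def fun_eq_iff)

text \<open>Both axioms relating the metrics concern the displacement \<open>g = w\<^sup>-\<^sup>1 w'\<close>. Its length is the distance
of the points, its \<open>H\<close>-component is the relative position of the lamplighters, and its support consists of
the positions of the differing lamps as seen from the lamplighter of \<open>w\<close>. A bound on the length leaves
finitely many \<open>g\<close>, hence bounds these data; conversely a bound on these data leaves finitely many
\<open>g\<close>, as \<open>E\<close> and the balls of \<open>H\<close> are finite.\<close>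

lemma lamplighter_wreath_product:
  fixes E :: "('e, 'm) monoid_scheme" and H :: "('h, 'n) monoid_scheme"
  assumes E: "group E" "finite (carrier E)" and H: "group H" "infinite (carrier H)"
    and U: "finite_generating_set H U" and S: "finite_generating_set (wreath_product E H) S"
  shows "lamplighter (carrier H) (word_dist H U) (carrier E) \<one>\<^bsub>E\<^esub> (word_dist (wreath_product E H) S)"
proof -
  let ?G = "wreath_product E H"
  let ?Conf = "configurations (carrier H) (carrier E) \<one>\<^bsub>E\<^esub>"
  interpret E: group E by fact
  interpret H: group H by fact
  interpret G: group ?G by (rule group_wreath_product[OF E(1) H(1)])
  note G = G.is_group
  note car = carrier_wreath_product[OF E(1), of H]
  have displacement: "\<exists>g. g \<in> ?Conf \<times> carrier H \<and> word_dist ?G S w w' = word_length ?G S g \<and>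
      word_dist H U (snd w) (snd w') = word_length H U (snd g) \<and>
      (\<forall>k\<in>carrier H. fst w k \<noteq> fst w' k \<longleftrightarrow> fst g (inv\<^bsub>H\<^esub> (snd w) \<otimes>\<^bsub>H\<^esub> k) \<noteq> \<one>\<^bsub>E\<^esub>)"
    if w: "w \<in> ?Conf \<times> carrier H" "w' \<in> ?Conf \<times> carrier H" for w w'
  proof -
    obtain a x b y where ws: "w = (a, x)" "w' = (b, y)" by (metis surj_pair)
    define g where "g = inv\<^bsub>?G\<^esub> w \<otimes>\<^bsub>?G\<^esub> w'"
    have wG: "w \<in> carrier ?G" "w' \<in> carrier ?G" using w unfolding car by simp_all
    then have g: "g \<in> carrier ?G" "w \<otimes>\<^bsub>?G\<^esub> g = w'" unfolding g_def by (simp_all add: G.m_assoc[symmetric])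
    obtain c h where gs: "g = (c, h)" by (metis surj_pair)
    have x: "x \<in> carrier H" and h: "h \<in> carrier H" and c: "c \<in> ?Conf" and a: "a \<in> ?Conf"
      using w g(1) unfolding ws gs car by simp_all
    have b: "b = (\<lambda>k\<in>carrier H. a k \<otimes>\<^bsub>E\<^esub> c (inv\<^bsub>H\<^esub> x \<otimes>\<^bsub>H\<^esub> k))" and y: "y = x \<otimes>\<^bsub>H\<^esub> h"
      using g(2) mult_wreath_product[OF H(1) x, where E = E and a = a and b = c and h = h] unfolding ws gs by simp_all
    have "a k \<noteq> b k \<longleftrightarrow> c (inv\<^bsub>H\<^esub> x \<otimes>\<^bsub>H\<^esub> k) \<noteq> \<one>\<^bsub>E\<^esub>" if k: "k \<in> carrier H" for k
    proof -
      have "a k \<in> carrier E" "c (inv\<^bsub>H\<^esub> x \<otimes>\<^bsub>H\<^esub> k) \<in> carrier E"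
        using a c k x unfolding configurations_def by (auto dest: PiE_mem)
      then show ?thesis unfolding b using k by auto
    qed
    moreover have "inv\<^bsub>H\<^esub> x \<otimes>\<^bsub>H\<^esub> y = h" unfolding y using x h by (simp add: H.m_assoc[symmetric])
    then have "word_dist H U x y = word_length H U h"
      using x h y by (simp add: word_dist_def)
    moreover have "word_dist ?G S w w' = word_length ?G S g"
      using wG unfolding word_dist_def g_def by simp
    ultimately show ?thesis using g(1) unfolding car by (intro exI[of _ g]) (simp add: ws gs)
  qed
  have shift: "word_dist H U x k = word_length H U (inv\<^bsub>H\<^esub> x \<otimes>\<^bsub>H\<^esub> k)" if "x \<in> carrier H" "k \<in> carrier H" for x k
    using that by (simp add: word_dist_def)
  show ?thesis
  proof (rule lamplighter.intro)
    show "Metric_space (carrier H) (word_dist H U)" by (rule Metric_space_word_dist[OF H(1) U])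
    show "Metric_space (?Conf \<times> carrier H) (word_dist ?G S)"
      using Metric_space_word_dist[OF G S] unfolding car .
    show "lamplighter_axioms (carrier H) (word_dist H U) (carrier E) \<one>\<^bsub>E\<^esub> (word_dist ?G S)"
    proof
      show "infinite (carrier H)" "finite (carrier E)" "\<one>\<^bsub>E\<^esub> \<in> carrier E" using H E by auto
      show "finite {y \<in> carrier H. word_dist H U x y \<le> r}" if "x \<in> carrier H" for x r
        by (rule finite_word_dist_ball[OF H(1) U that])
    next
      fix r
      let ?B = "{g \<in> carrier ?G. real (word_length ?G S g) \<le> r}"
      let ?Z = "\<Union>g\<in>?B. insert (snd g) {k \<in> carrier H. fst g k \<noteq> \<one>\<^bsub>E\<^esub>}"
      have "finite {k \<in> carrier H. fst g k \<noteq> \<one>\<^bsub>E\<^esub>}" if "g \<in> carrier ?G" for g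
        using that unfolding car by (auto simp: configurations_def)
      then have "finite ?Z" using finite_word_length_ball[OF G S, of r] by auto
      then have "finite (word_length H U ` ?Z)" by (rule finite_imageI)
      then obtain \<rho> where \<rho>: "\<And>z. z \<in> ?Z \<Longrightarrow> word_length H U z \<le> \<rho>"
        unfolding finite_nat_set_iff_bounded_le by blast
      show "\<exists>\<rho>. \<forall>w\<in>?Conf \<times> carrier H. \<forall>w'\<in>?Conf \<times> carrier H. word_dist ?G S w w' \<le> r \<longrightarrow>
        word_dist H U (snd w) (snd w') \<le> \<rho> \<and> (\<forall>k\<in>carrier H. fst w k \<noteq> fst w' k \<longrightarrow> word_dist H U (snd w) k \<le> \<rho>)"
      proof (intro exI[of _ "real \<rho>"] ballI impI)
        fix w w' assume w: "w \<in> ?Conf \<times> carrier H" "w' \<in> ?Conf \<times> carrier H" and "word_dist ?G S w w' \<le> r"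
        then obtain g where g: "g \<in> ?B" "word_dist H U (snd w) (snd w') = word_length H U (snd g)"
          "\<forall>k\<in>carrier H. fst w k \<noteq> fst w' k \<longleftrightarrow> fst g (inv\<^bsub>H\<^esub> (snd w) \<otimes>\<^bsub>H\<^esub> k) \<noteq> \<one>\<^bsub>E\<^esub>"
          using displacement[OF w] unfolding car by auto
        have "word_length H U (snd g) \<le> \<rho>" using \<rho>[of "snd g"] g(1) by blast
        moreover have "word_dist H U (snd w) k \<le> \<rho>" if k: "k \<in> carrier H" "fst w k \<noteq> fst w' k" for k
        proof -
          have x: "snd w \<in> carrier H" using w(1) by auto
          then have "inv\<^bsub>H\<^esub> (snd w) \<otimes>\<^bsub>H\<^esub> k \<in> ?Z" using g(3) k by (intro UN_I[OF g(1)]) auto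
          then show ?thesis using \<rho> shift[OF x k(1)] by simp
        qed
        ultimately show "word_dist H U (snd w) (snd w') \<le> \<rho> \<and>
            (\<forall>k\<in>carrier H. fst w k \<noteq> fst w' k \<longrightarrow> word_dist H U (snd w) k \<le> \<rho>)"
          using g(2) by simp
      qed
    next
      fix \<rho>
      let ?B = "{h \<in> carrier H. real (word_length H U h) \<le> \<rho>}"
      let ?Z = "{c \<in> ?Conf. \<forall>k\<in>carrier H - ?B. c k = \<one>\<^bsub>E\<^esub>} \<times> ?B"
      have "finite ?B" by (rule finite_word_length_ball[OF H(1) U])
      then have "finite ?Z"
        using card_supported_configurations(2)[of ?B "carrier H" "\<one>\<^bsub>E\<^esub>" "carrier E"] E(2) by auto
      then have "finite (word_length ?G S ` ?Z)" by (rule finite_imageI)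
      then obtain r where r: "\<And>z. z \<in> ?Z \<Longrightarrow> word_length ?G S z \<le> r"
        unfolding finite_nat_set_iff_bounded_le by blast
      show "\<exists>r. \<forall>w\<in>?Conf \<times> carrier H. \<forall>w'\<in>?Conf \<times> carrier H.
        word_dist H U (snd w) (snd w') \<le> \<rho> \<and> (\<forall>k\<in>carrier H. fst w k \<noteq> fst w' k \<longrightarrow> word_dist H U (snd w) k \<le> \<rho>) \<longrightarrow>
        word_dist ?G S w w' \<le> r"
      proof (intro exI[of _ "real r"] ballI impI)
        fix w w' assume w: "w \<in> ?Conf \<times> carrier H" "w' \<in> ?Conf \<times> carrier H"
          and near: "word_dist H U (snd w) (snd w') \<le> \<rho> \<and>
            (\<forall>k\<in>carrier H. fst w k \<noteq> fst w' k \<longrightarrow> word_dist H U (snd w) k \<le> \<rho>)"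
        obtain g where g: "g \<in> ?Conf \<times> carrier H" "word_dist ?G S w w' = word_length ?G S g"
          "word_dist H U (snd w) (snd w') = word_length H U (snd g)"
          "\<forall>k\<in>carrier H. fst w k \<noteq> fst w' k \<longleftrightarrow> fst g (inv\<^bsub>H\<^esub> (snd w) \<otimes>\<^bsub>H\<^esub> k) \<noteq> \<one>\<^bsub>E\<^esub>"
          using displacement[OF w] by blast
        have x: "snd w \<in> carrier H" using w(1) by auto
        have "k \<in> ?B" if k: "k \<in> carrier H" "fst g k \<noteq> \<one>\<^bsub>E\<^esub>" for k
        proof -
          have "inv\<^bsub>H\<^esub> (snd w) \<otimes>\<^bsub>H\<^esub> (snd w \<otimes>\<^bsub>H\<^esub> k) = k" using x k(1) by (simp add: H.m_assoc[symmetric])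
          moreover have m: "snd w \<otimes>\<^bsub>H\<^esub> k \<in> carrier H" using x k(1) by simp
          ultimately have "fst w (snd w \<otimes>\<^bsub>H\<^esub> k) \<noteq> fst w' (snd w \<otimes>\<^bsub>H\<^esub> k)"
            "word_dist H U (snd w) (snd w \<otimes>\<^bsub>H\<^esub> k) = word_length H U k"
            using bspec[OF g(4) m] shift[OF x m] k(2) by simp_all
          then show ?thesis using near m k(1) by auto
        qed
        then have "g \<in> ?Z" using g(1,3) near by (auto simp: mem_Times_iff)
        then show "word_dist ?G S w w' \<le> r" using r g(2) by simp
      qed
    qed
  qed
qed

lemma quasi_isometric_coarse_inverse:
  assumes M: "Metric_space M d" and M': "Metric_space M' d'" and qi: "quasi_isometric M d M' d'"
  obtains f f' \<sigma> b where "f \<in> M \<rightarrow> M'" "f' \<in> M' \<rightarrow> M" "controlled M d d' f \<sigma>" "controlled M' d' d f' \<sigma>"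
    "\<And>x. x \<in> M \<Longrightarrow> d x (f' (f x)) \<le> b" "\<And>y. y \<in> M' \<Longrightarrow> d' y (f (f' y)) \<le> b"
proof -
  interpret M: Metric_space M d by fact
  interpret M': Metric_space M' d' by fact
  obtain f A B where f: "f \<in> M \<rightarrow> M'" and A: "1 \<le> A" and B: "0 \<le> B"
    and bounds: "\<forall>x\<in>M. \<forall>y\<in>M. d x y / A - B \<le> d' (f x) (f y) \<and> d' (f x) (f y) \<le> A * d x y + B"
    and onto: "\<forall>z\<in>M'. \<exists>x\<in>M. d' z (f x) \<le> B"
    using qi unfolding quasi_isometric_def by (elim exE conjE) (rule that)
  obtain f' where f': "\<And>z. z \<in> M' \<Longrightarrow> f' z \<in> M \<and> d' z (f (f' z)) \<le> B" using onto by metis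
  have lower: "d x y \<le> A * (d' (f x) (f y) + B)" if "x \<in> M" "y \<in> M" for x y
    using bounds that A by (auto simp: field_simps)
  have fM: "f x \<in> M'" if "x \<in> M" for x using f that by blast
  define \<sigma> where "\<sigma> r = A * (r + 3 * B) + B" for r
  show ?thesis
  proof (rule that[of f f' \<sigma> "2 * A * B + B"])
    show "f' \<in> M' \<rightarrow> M" using f' by blast
    have AB: "0 \<le> A * B" using A B by simp
    show "controlled M d d' f \<sigma>"
      unfolding controlled_def \<sigma>_def
    proof (intro ballI allI impI)
      fix x y r assume "x \<in> M" "y \<in> M" "d x y \<le> r"
      then have "d' (f x) (f y) \<le> A * d x y + B" "A * d x y \<le> A * r" using bounds A by auto
      then show "d' (f x) (f y) \<le> A * (r + 3 * B) + B" using AB by (simp add: algebra_simps)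
    qed
    show "controlled M' d' d f' \<sigma>"
      unfolding controlled_def \<sigma>_def
    proof (intro ballI allI impI)
      fix x y r assume xy: "x \<in> M'" "y \<in> M'" "d' x y \<le> r"
      have "d' (f (f' x)) (f (f' y)) \<le> d' (f (f' x)) x + d' x y + d' y (f (f' y))"
        using M'.triangle[of "f (f' x)" x "f (f' y)"] M'.triangle[of x y "f (f' y)"]
          fM[of "f' x"] fM[of "f' y"] f'[OF xy(1)] f'[OF xy(2)] xy by linarith
      also have "\<dots> \<le> r + 2 * B" using f'[OF xy(1)] f'[OF xy(2)] xy(3) M'.commute[of x "f (f' x)"] by linarith
      finally have "A * (d' (f (f' x)) (f (f' y)) + B) \<le> A * (r + 3 * B)" using A by simp
      then show "d (f' x) (f' y) \<le> A * (r + 3 * B) + B" using lower[of "f' x" "f' y"] f'[OF xy(1)] f'[OF xy(2)] B by linarith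
    qed
    show "d x (f' (f x)) \<le> 2 * A * B + B" if x: "x \<in> M" for x
    proof -
      have "A * (d' (f x) (f (f' (f x))) + B) \<le> A * (2 * B)" using f'[OF fM[OF x]] A by simp
      then show ?thesis using lower[of x "f' (f x)"] f'[OF fM[OF x]] x B by (simp add: algebra_simps)
    qed
    show "d' y (f (f' y)) \<le> 2 * A * B + B" if "y \<in> M'" for y using f'[OF that] AB by simp
  qed (rule f)
qed

theorem theorem7p23:
  fixes E :: "('e, 'm) monoid_scheme" and F :: "('f, 'n) monoid_scheme"
    and H :: "('h, 'p) monoid_scheme" and K :: "('k, 'q) monoid_scheme"
  assumes "group E" and "finite (carrier E)"
    and "group F" and "finite (carrier F)"
    and "finitely_generated_group H" and "infinite (carrier H)" and "thick_bigon_group H"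
    and "finitely_generated_group K" and "infinite (carrier K)" and "thick_bigon_group K"
    and "quasi_isometric_groups (wreath_product E H) (wreath_product F K)"
  shows "prime_factors (order E) = prime_factors (order F)"
proof -
  have H: "group H" and K: "group K" using assms unfolding finitely_generated_group_def by auto
  obtain U where U: "finite_generating_set H U" "detour_property (carrier H) (word_dist H U)"
    using thick_bigon_group_imp_detour_property[OF H] assms by blast
  obtain V where V: "finite_generating_set K V" "detour_property (carrier K) (word_dist K V)"
    using thick_bigon_group_imp_detour_property[OF K] assms by blast
  let ?G = "wreath_product E H" and ?G' = "wreath_product F K"
  obtain S T where S: "finite_generating_set ?G S" and T: "finite_generating_set ?G' T"
    and qi: "quasi_isometric (carrier ?G) (word_dist ?G S) (carrier ?G') (word_dist ?G' T)"
    using assms(11) unfolding quasi_isometric_groups_def by blast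
  obtain f f' \<sigma> b where f: "f \<in> carrier ?G \<rightarrow> carrier ?G'" "f' \<in> carrier ?G' \<rightarrow> carrier ?G"
    "controlled (carrier ?G) (word_dist ?G S) (word_dist ?G' T) f \<sigma>"
    "controlled (carrier ?G') (word_dist ?G' T) (word_dist ?G S) f' \<sigma>"
    "\<And>x. x \<in> carrier ?G \<Longrightarrow> word_dist ?G S x (f' (f x)) \<le> b"
    "\<And>y. y \<in> carrier ?G' \<Longrightarrow> word_dist ?G' T y (f (f' y)) \<le> b"
    by (rule quasi_isometric_coarse_inverse[OF Metric_space_word_dist[OF _ S] Metric_space_word_dist[OF _ T] qi])
      (use group_wreath_product assms H K in auto)
  interpret lamplighter_equivalence
    "carrier H" "word_dist H U" "carrier E" "\<one>\<^bsub>E\<^esub>" "word_dist ?G S"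
    "carrier K" "word_dist K V" "carrier F" "\<one>\<^bsub>F\<^esub>" "word_dist ?G' T" f f' \<sigma> b
    by (intro lamplighter_equivalence.intro lamplighter_equivalence_axioms.intro lamplighter_wreath_product)
      (use f U V S T H K assms in \<open>simp_all add: carrier_wreath_product\<close>)
  have "order E \<noteq> 0" "order F \<noteq> 0"
    using assms group.is_monoid monoid.one_closed unfolding order_def by (metis card_0_eq empty_iff)+
  moreover have "\<exists>n. order E dvd order F ^ n" "\<exists>n. order F dvd order E ^ n"
    using card_values_dvd lamplighter_equivalence.card_values_dvd[OF swapped] unfolding order_def .
  then have "p dvd order F" if "prime p" "p dvd order E" for p
    using that by (meson dvd_trans prime_dvd_power)
  moreover have "p dvd order E" if "prime p" "p dvd order F" for p
    using that \<open>\<exists>n. order F dvd order E ^ n\<close> by (meson dvd_trans prime_dvd_power)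
  ultimately show ?thesis by (auto simp: in_prime_factors_iff)
qed

end
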